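(* Let $G$ be a second countable locally compact Hausdorff transitive groupoid with a left Haar system, let $u\in G^0$, and suppose the range map $r:G_u\to G^0$ admits a continuous section $\gamma$, i.e. a continuous map $\gamma:G^0\to G_u$ with $r\circ\gamma=\mathrm{id}_{G^0}$. Then for every amenable unitary representation $\pi$ of the isotropy group $G^u_u$ there exists an amenable continuous unitary representation $\pi'$ of $G$ such that $\pi'|_{G^u_u}$ is unitarily equivalent to $\pi$.
   Context: $G^0$ is the unit space, $r,d:G\to G^0$ the range and domain maps, $G^u=r^{-1}(u)$, $G_u=d^{-1}(u)$, $G^u_u=G^u\cap G_u$ (a locally compact group). Transitive: for all $v,w\in G^0$ there is $x\in G$ with $d(x)=v$, $r(x)=w$. A left Haar system is a family $\{\lambda^u\}_{u\in G^0}$ of positive Radon measures on $G$ with $\operatorname{supp}\lambda^u=G^u$, $u\mapsto\int f\,d\lambda^u$ continuous for $f\in C_c(G)$, and left invariant. Representations. A continuous Hilbert bundle over $G^0$ is a continuous field $\{\mathcal H_v\}_{v\in G^0}$ of separable Hilbert spaces; $C_0(G^0,\mathcal H)$ is its space of continuous sections vanishing at infinity, a left Hilbert $C_0(G^0)$-module. A continuous unitary representation $(\mathcal H^\pi,\pi)$ of a groupoid $G$ is a continuous Hilbert bundle over $G^0$ with unitaries $\pi(x):\mathcal H^\pi_{d(x)}\to\mathcal H^\pi_{r(x)}$ such that $\pi(v)=\mathrm{id}$ for $v\in G^0$, $\pi(xy)=\pi(x)\pi(y)$, $\pi(x)^{-1}=\pi(x^{-1})$, and $x\mapsto\langle\pi(x)\xi(d(x)),\eta(r(x))\rangle$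 is continuous for $\xi,\eta\in C_0(G^0,\mathcal H^\pi)$. All representations are assumed to have all fibers non-zero and $C_0(G^0,\mathcal H^\pi)$ countably generated. Amenable representation. For $T$ adjointable on $C_0(G^0,\mathcal H^\pi)$, $T_v$ is its localization on $\mathcal H^\pi_v$, $(T\xi)(v)=T_v\xi(v)$. $T$ is Hilbert–Schmidt if $v\mapsto\operatorname{Tr}(|T_v|^2)$ lies in $C_0(G^0)$; $\|T_v\|_2=\operatorname{Tr}(|T_v|^2)^{1/2}$, $\|T\|_2=\sup_v\|T_v\|_2$. Put $x\cdot T_{d(x)}=\pi(x)T_{d(x)}\pi(x^{-1})$. $\pi$ is amenable if there is a net $\{T^i\}$ of Hilbert–Schmidt operators on $C_0(G^0,\mathcal H^\pi)$ with $\|T^i\|_2\le1$, $\|T^i_v\|_2\to1$ uniformly on compact subsets of $G^0$, and $\langle x\cdot T^i_{d(x)},T^i_{r(x)}\rangle\to1$ (Hilbert–Schmidt inner product) uniformly on compact subsets of $G$. The same definition is used for a group, viewed as a groupoid whose unit space is a point. *)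

theory Defs
  imports "HOL-Analysis.Analysis" "HOL-Algebra.Module"
begin

section \<open>Complex Hilbert spaces with explicit carriers\<close>

text \<open>
  The fibres of a Hilbert bundle are different Hilbert spaces, so a Hilbert space is an
  algebraic structure and not a type.  The multiplicative part of the underlying ring record is
  not used.  Inner products are linear in the first argument.
\<close>

record 'h hilb = "(complex, 'h) module" +
  hinner :: "'h \<Rightarrow> 'h \<Rightarrow> complex"

definition complex_ring :: "complex ring" where
  "complex_ring = \<lparr>carrier = UNIV, mult = (*), one = 1, zero = 0, add = (+)\<rparr>"

definition hnorm :: "'h hilb \<Rightarrow> 'h \<Rightarrow> real" where
  "hnorm H x = sqrt (Re (hinner H x x))"

text \<open>The value 0 off the carrier is what the locale \<^locale>\<open>Metric_space\<close> needs, whose axioms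
  of nonnegativity and symmetry are not relativised.\<close>

definition hdist :: "'h hilb \<Rightarrow> 'h \<Rightarrow> 'h \<Rightarrow> real" where
  "hdist H x y = (if x \<in> carrier H \<and> y \<in> carrier H then hnorm H (x \<ominus>\<^bsub>H\<^esub> y) else 0)"

abbreviation htopology :: "'h hilb \<Rightarrow> 'h topology" where
  "htopology H \<equiv> Metric_space.mtopology (carrier H) (hdist H)"

definition hilbert_space :: "'h hilb \<Rightarrow> bool" where
  "hilbert_space H \<longleftrightarrow>
     module complex_ring H \<and>
     (\<forall>x\<in>carrier H. \<forall>y\<in>carrier H. \<forall>z\<in>carrier H.
        hinner H (x \<oplus>\<^bsub>H\<^esub> y) z = hinner H x z + hinner H y z) \<and>
     (\<forall>a. \<forall>x\<in>carrier H. \<forall>y\<in>carrier H. hinner H (a \<odot>\<^bsub>H\<^esub> x) y = a * hinner H x y) \<and>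
     (\<forall>x\<in>carrier H. \<forall>y\<in>carrier H. hinner H y x = cnj (hinner H x y)) \<and>
     (\<forall>x\<in>carrier H. 0 \<le> Re (hinner H x x)) \<and>
     (\<forall>x\<in>carrier H. hinner H x x = 0 \<longrightarrow> x = \<zero>\<^bsub>H\<^esub>) \<and>
     Metric_space.mcomplete (carrier H) (hdist H)"

definition unitary_map :: "'h hilb \<Rightarrow> 'k hilb \<Rightarrow> ('h \<Rightarrow> 'k) \<Rightarrow> bool" where
  "unitary_map H K U \<longleftrightarrow>
     bij_betw U (carrier H) (carrier K) \<and>
     (\<forall>x\<in>carrier H. \<forall>y\<in>carrier H. U (x \<oplus>\<^bsub>H\<^esub> y) = U x \<oplus>\<^bsub>K\<^esub> U y) \<and>
     (\<forall>a. \<forall>x\<in>carrier H. U (a \<odot>\<^bsub>H\<^esub> x) = a \<odot>\<^bsub>K\<^esub> U x) \<and>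
     (\<forall>x\<in>carrier H. \<forall>y\<in>carrier H. hinner K (U x) (U y) = hinner H x y)"

definition hadjoint :: "'h hilb \<Rightarrow> ('h \<Rightarrow> 'h) \<Rightarrow> 'h \<Rightarrow> 'h" where
  "hadjoint H A y =
     (THE z. z \<in> carrier H \<and> (\<forall>x\<in>carrier H. hinner H (A x) y = hinner H x z))"

definition orthonormal_basis :: "'h hilb \<Rightarrow> 'h set \<Rightarrow> bool" where
  "orthonormal_basis H B \<longleftrightarrow>
     B \<subseteq> carrier H \<and>
     (\<forall>e\<in>B. \<forall>f\<in>B. hinner H e f = (if e = f then 1 else 0)) \<and>
     (\<forall>x\<in>carrier H. (\<forall>e\<in>B. hinner H x e = 0) \<longrightarrow> x = \<zero>\<^bsub>H\<^esub>)"

text \<open>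
  The trace is computed in one chosen orthonormal basis.  For positive operators and for products
  of two Hilbert-Schmidt operators, the only ones it is applied to, neither its summability nor its
  value depends on the choice.  Since \<^term>\<open>infsum\<close> of a non-summable family is 0, finiteness is
  a separate predicate.
\<close>

definition onb :: "'h hilb \<Rightarrow> 'h set" where
  "onb H = (SOME B. orthonormal_basis H B)"

definition htrace_finite :: "'h hilb \<Rightarrow> ('h \<Rightarrow> 'h) \<Rightarrow> bool" where
  "htrace_finite H A \<longleftrightarrow> (\<lambda>e. hinner H (A e) e) summable_on onb H"

definition htrace :: "'h hilb \<Rightarrow> ('h \<Rightarrow> 'h) \<Rightarrow> complex" where
  "htrace H A = (\<Sum>\<^sub>\<infinity>e\<in>onb H. hinner H (A e) e)"

definition abs_sq :: "'h hilb \<Rightarrow> ('h \<Rightarrow> 'h) \<Rightarrow> 'h \<Rightarrow> 'h" where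
  "abs_sq H A x = hadjoint H A (A x)"

definition hs_norm :: "'h hilb \<Rightarrow> ('h \<Rightarrow> 'h) \<Rightarrow> real" where
  "hs_norm H A = sqrt (Re (htrace H (abs_sq H A)))"

definition hs_inner :: "'h hilb \<Rightarrow> ('h \<Rightarrow> 'h) \<Rightarrow> ('h \<Rightarrow> 'h) \<Rightarrow> complex" where
  "hs_inner H A B = htrace H (\<lambda>x. hadjoint H B (A x))"


section \<open>Topological groupoids and Haar systems\<close>

text \<open>\<^term>\<open>gmul G x y\<close> is meaningful only for composable pairs, that is, if
  \<^term>\<open>gdom G x = grng G y\<close>; units are elements of the groupoid.\<close>

record 'g tgroupoid =
  gtop :: "'g topology"
  grng :: "'g \<Rightarrow> 'g"
  gdom :: "'g \<Rightarrow> 'g"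
  gmul :: "'g \<Rightarrow> 'g \<Rightarrow> 'g"
  ginv :: "'g \<Rightarrow> 'g"

abbreviation gset :: "'g tgroupoid \<Rightarrow> 'g set" where
  "gset G \<equiv> topspace (gtop G)"

definition units :: "'g tgroupoid \<Rightarrow> 'g set" where
  "units G = gdom G ` gset G"

definition unit_space :: "'g tgroupoid \<Rightarrow> 'g topology" where
  "unit_space G = subtopology (gtop G) (units G)"

definition range_fibre :: "'g tgroupoid \<Rightarrow> 'g \<Rightarrow> 'g set" where
  "range_fibre G v = {x \<in> gset G. grng G x = v}"

definition domain_fibre :: "'g tgroupoid \<Rightarrow> 'g \<Rightarrow> 'g set" where
  "domain_fibre G v = {x \<in> gset G. gdom G x = v}"

definition composable :: "'g tgroupoid \<Rightarrow> ('g \<times> 'g) set" where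
  "composable G = {(x, y). x \<in> gset G \<and> y \<in> gset G \<and> gdom G x = grng G y}"

definition topological_groupoid :: "'g tgroupoid \<Rightarrow> bool" where
  "topological_groupoid G \<longleftrightarrow>
     (\<forall>x\<in>gset G. grng G x \<in> units G) \<and>
     (\<forall>v\<in>units G. v \<in> gset G \<and> grng G v = v \<and> gdom G v = v) \<and>
     (\<forall>(x, y)\<in>composable G.
        gmul G x y \<in> gset G \<and> grng G (gmul G x y) = grng G x \<and> gdom G (gmul G x y) = gdom G y) \<and>
     (\<forall>x y z. (x, y) \<in> composable G \<and> (y, z) \<in> composable G \<longrightarrow>
        gmul G (gmul G x y) z = gmul G x (gmul G y z)) \<and>
     (\<forall>x\<in>gset G. gmul G (grng G x) x = x \<and> gmul G x (gdom G x) = x) \<and>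
     (\<forall>x\<in>gset G. ginv G x \<in> gset G \<and>
        grng G (ginv G x) = gdom G x \<and> gdom G (ginv G x) = grng G x \<and>
        gmul G x (ginv G x) = grng G x \<and> gmul G (ginv G x) x = gdom G x) \<and>
     continuous_map (subtopology (prod_topology (gtop G) (gtop G)) (composable G)) (gtop G)
       (\<lambda>(x, y). gmul G x y) \<and>
     continuous_map (gtop G) (gtop G) (ginv G)"

definition transitive_groupoid :: "'g tgroupoid \<Rightarrow> bool" where
  "transitive_groupoid G \<longleftrightarrow>
     (\<forall>v\<in>units G. \<forall>w\<in>units G. \<exists>x\<in>gset G. gdom G x = v \<and> grng G x = w)"

definition isotropy :: "'g tgroupoid \<Rightarrow> 'g \<Rightarrow> 'g tgroupoid" where
  "isotropy G u = G\<lparr>gtop := subtopology (gtop G) (range_fibre G u \<inter> domain_fibre G u)\<rparr>"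

definition radon_measure :: "'g topology \<Rightarrow> 'g measure \<Rightarrow> bool" where
  "radon_measure X M \<longleftrightarrow>
     space M = topspace X \<and>
     sets M = sigma_sets (topspace X) {U. openin X U} \<and>
     (\<forall>K. compactin X K \<longrightarrow> emeasure M K < \<infinity>) \<and>
     (\<forall>A\<in>sets M. emeasure M A = (INF U\<in>{U. openin X U \<and> A \<subseteq> U}. emeasure M U)) \<and>
     (\<forall>U. openin X U \<longrightarrow> emeasure M U = (SUP K\<in>{K. compactin X K \<and> K \<subseteq> U}. emeasure M K))"

definition measure_support :: "'g topology \<Rightarrow> 'g measure \<Rightarrow> 'g set" where
  "measure_support X M = {x \<in> topspace X. \<forall>U. openin X U \<and> x \<in> U \<longrightarrow> emeasure M U > 0}"

definition compactly_supported :: "'g topology \<Rightarrow> ('g \<Rightarrow> complex) \<Rightarrow> bool" where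
  "compactly_supported X f \<longleftrightarrow>
     continuous_map X euclidean f \<and> compactin X (X closure_of {x \<in> topspace X. f x \<noteq> 0})"

text \<open>In the invariance law the left-hand integral is restricted to the fibre carrying the
  measure, because the product is meaningless (and need not be measurable) elsewhere.\<close>

definition left_haar_system :: "'g tgroupoid \<Rightarrow> ('g \<Rightarrow> 'g measure) \<Rightarrow> bool" where
  "left_haar_system G lam \<longleftrightarrow>
     (\<forall>v\<in>units G. radon_measure (gtop G) (lam v) \<and>
        measure_support (gtop G) (lam v) = range_fibre G v) \<and>
     (\<forall>f. compactly_supported (gtop G) f \<longrightarrow>
        continuous_map (unit_space G) euclidean (\<lambda>v. LINT y|lam v. f y)) \<and>
     (\<forall>f. \<forall>x\<in>gset G. compactly_supported (gtop G) f \<longrightarrow>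
        (LINT y:range_fibre G (gdom G x)|lam (gdom G x). f (gmul G x y)) =
        (LINT y|lam (grng G x). f y))"


section \<open>Continuous Hilbert bundles and operators on sections\<close>

definition c0_function :: "'a topology \<Rightarrow> ('a \<Rightarrow> 'b::real_normed_vector) \<Rightarrow> bool" where
  "c0_function X f \<longleftrightarrow>
     continuous_map X euclidean f \<and>
     (\<forall>\<epsilon>>0. compactin X {x \<in> topspace X. \<epsilon> \<le> norm (f x)})"

text \<open>A bundle consists of its fibres and its continuous sections.  Sections are extensional
  functions (constantly \<^term>\<open>undefined\<close> off the base space).\<close>

record ('a, 'h) hilbert_bundle =
  fibre :: "'a \<Rightarrow> 'h hilb"
  cts_sections :: "('a \<Rightarrow> 'h) set"

definition sec_zero :: "'a topology \<Rightarrow> ('a, 'h) hilbert_bundle \<Rightarrow> 'a \<Rightarrow> 'h" where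
  "sec_zero X E = (\<lambda>v\<in>topspace X. \<zero>\<^bsub>fibre E v\<^esub>)"

definition sec_add ::
    "'a topology \<Rightarrow> ('a, 'h) hilbert_bundle \<Rightarrow> ('a \<Rightarrow> 'h) \<Rightarrow> ('a \<Rightarrow> 'h) \<Rightarrow> 'a \<Rightarrow> 'h" where
  "sec_add X E \<xi> \<eta> = (\<lambda>v\<in>topspace X. \<xi> v \<oplus>\<^bsub>fibre E v\<^esub> \<eta> v)"

definition sec_scale ::
    "'a topology \<Rightarrow> ('a, 'h) hilbert_bundle \<Rightarrow> ('a \<Rightarrow> complex) \<Rightarrow> ('a \<Rightarrow> 'h) \<Rightarrow> 'a \<Rightarrow> 'h" where
  "sec_scale X E a \<xi> = (\<lambda>v\<in>topspace X. a v \<odot>\<^bsub>fibre E v\<^esub> \<xi> v)"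

text \<open>Continuous fields of separable Hilbert spaces in the sense of Godement and Dixmier; the last
  condition is completeness under locally uniform approximation.\<close>

definition continuous_hilbert_bundle :: "'a topology \<Rightarrow> ('a, 'h) hilbert_bundle \<Rightarrow> bool" where
  "continuous_hilbert_bundle X E \<longleftrightarrow>
     (\<forall>v\<in>topspace X. hilbert_space (fibre E v) \<and> separable_space (htopology (fibre E v))) \<and>
     cts_sections E \<subseteq> (\<Pi>\<^sub>E v\<in>topspace X. carrier (fibre E v)) \<and>
     sec_zero X E \<in> cts_sections E \<and>
     (\<forall>\<xi>\<in>cts_sections E. \<forall>\<eta>\<in>cts_sections E. sec_add X E \<xi> \<eta> \<in> cts_sections E) \<and>
     (\<forall>c. \<forall>\<xi>\<in>cts_sections E. sec_scale X E (\<lambda>_. c) \<xi> \<in> cts_sections E) \<and>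
     (\<forall>v\<in>topspace X.
        htopology (fibre E v) closure_of ((\<lambda>\<xi>. \<xi> v) ` cts_sections E) = carrier (fibre E v)) \<and>
     (\<forall>\<xi>\<in>cts_sections E. continuous_map X euclideanreal (\<lambda>v. hnorm (fibre E v) (\<xi> v))) \<and>
     (\<forall>\<xi>\<in>(\<Pi>\<^sub>E v\<in>topspace X. carrier (fibre E v)).
        (\<forall>v\<in>topspace X. \<forall>\<epsilon>>0. \<exists>\<eta>\<in>cts_sections E. \<exists>U. openin X U \<and> v \<in> U \<and>
           (\<forall>w\<in>U. hdist (fibre E w) (\<xi> w) (\<eta> w) < \<epsilon>)) \<longrightarrow> \<xi> \<in> cts_sections E)"

definition c0_sections :: "'a topology \<Rightarrow> ('a, 'h) hilbert_bundle \<Rightarrow> ('a \<Rightarrow> 'h) set" where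
  "c0_sections X E = {\<xi> \<in> cts_sections E. c0_function X (\<lambda>v. hnorm (fibre E v) (\<xi> v))}"

definition closed_submodule :: "'a topology \<Rightarrow> ('a, 'h) hilbert_bundle \<Rightarrow> ('a \<Rightarrow> 'h) set \<Rightarrow> bool" where
  "closed_submodule X E M \<longleftrightarrow>
     M \<subseteq> c0_sections X E \<and>
     sec_zero X E \<in> M \<and>
     (\<forall>\<xi>\<in>M. \<forall>\<eta>\<in>M. sec_add X E \<xi> \<eta> \<in> M) \<and>
     (\<forall>c. \<forall>\<xi>\<in>M. sec_scale X E (\<lambda>_. c) \<xi> \<in> M) \<and>
     (\<forall>a. \<forall>\<xi>\<in>M. c0_function X a \<longrightarrow> sec_scale X E a \<xi> \<in> M) \<and>
     (\<forall>\<xi>\<in>c0_sections X E.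
        (\<forall>\<epsilon>>0. \<exists>\<eta>\<in>M. \<forall>v\<in>topspace X. hdist (fibre E v) (\<xi> v) (\<eta> v) < \<epsilon>) \<longrightarrow> \<xi> \<in> M)"

definition countably_generated :: "'a topology \<Rightarrow> ('a, 'h) hilbert_bundle \<Rightarrow> bool" where
  "countably_generated X E \<longleftrightarrow>
     (\<exists>S. countable S \<and> S \<subseteq> c0_sections X E \<and>
        (\<forall>M. closed_submodule X E M \<and> S \<subseteq> M \<longrightarrow> M = c0_sections X E))"

type_synonym ('a, 'h) section_operator = "('a \<Rightarrow> 'h) \<Rightarrow> 'a \<Rightarrow> 'h"

definition adjointable ::
    "'a topology \<Rightarrow> ('a, 'h) hilbert_bundle \<Rightarrow> ('a, 'h) section_operator \<Rightarrow> bool" where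
  "adjointable X E T \<longleftrightarrow>
     T ` c0_sections X E \<subseteq> c0_sections X E \<and>
     (\<exists>S. S ` c0_sections X E \<subseteq> c0_sections X E \<and>
        (\<forall>\<xi>\<in>c0_sections X E. \<forall>\<eta>\<in>c0_sections X E. \<forall>v\<in>topspace X.
           hinner (fibre E v) (T \<xi> v) (\<eta> v) = hinner (fibre E v) (\<xi> v) (S \<eta> v)))"

text \<open>
  Over a locally compact Hausdorff base every vector of a fibre is the value of some element of
  \<^term>\<open>c0_sections X E\<close>, and for adjointable \<^term>\<open>T\<close> the value of \<^term>\<open>T \<xi>\<close> at
  \<^term>\<open>v\<close> depends only on \<^term>\<open>\<xi> v\<close>.  So the choice below does not matter, and the result
  is the unique operator on the fibre sending each \<^term>\<open>\<xi> v\<close> to \<^term>\<open>T \<xi> v\<close>.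
\<close>

definition localization ::
    "'a topology \<Rightarrow> ('a, 'h) hilbert_bundle \<Rightarrow> ('a, 'h) section_operator \<Rightarrow> 'a \<Rightarrow> 'h \<Rightarrow> 'h" where
  "localization X E T v =
     (\<lambda>h\<in>carrier (fibre E v). T (SOME \<xi>. \<xi> \<in> c0_sections X E \<and> \<xi> v = h) v)"

definition hilbert_schmidt ::
    "'a topology \<Rightarrow> ('a, 'h) hilbert_bundle \<Rightarrow> ('a, 'h) section_operator \<Rightarrow> bool" where
  "hilbert_schmidt X E T \<longleftrightarrow>
     adjointable X E T \<and>
     (\<forall>v\<in>topspace X. htrace_finite (fibre E v) (abs_sq (fibre E v) (localization X E T v))) \<and>
     c0_function X (\<lambda>v. htrace (fibre E v) (abs_sq (fibre E v) (localization X E T v)))"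


section \<open>Unitary representations and amenability\<close>

definition unitary_rep ::
    "'g tgroupoid \<Rightarrow> ('g, 'h) hilbert_bundle \<Rightarrow> ('g \<Rightarrow> 'h \<Rightarrow> 'h) \<Rightarrow> bool" where
  "unitary_rep G E \<pi> \<longleftrightarrow>
     continuous_hilbert_bundle (unit_space G) E \<and>
     (\<forall>v\<in>units G. carrier (fibre E v) \<noteq> {\<zero>\<^bsub>fibre E v\<^esub>}) \<and>
     countably_generated (unit_space G) E \<and>
     (\<forall>x\<in>gset G. unitary_map (fibre E (gdom G x)) (fibre E (grng G x)) (\<pi> x)) \<and>
     (\<forall>v\<in>units G. \<forall>h\<in>carrier (fibre E v). \<pi> v h = h) \<and>
     (\<forall>(x, y)\<in>composable G. \<forall>h\<in>carrier (fibre E (gdom G y)). \<pi> (gmul G x y) h = \<pi> x (\<pi> y h)) \<and>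
     (\<forall>x\<in>gset G. \<forall>h\<in>carrier (fibre E (grng G x)).
        \<pi> (ginv G x) h = inv_into (carrier (fibre E (gdom G x))) (\<pi> x) h) \<and>
     (\<forall>\<xi>\<in>c0_sections (unit_space G) E. \<forall>\<eta>\<in>c0_sections (unit_space G) E.
        continuous_map (gtop G) euclidean
          (\<lambda>x. hinner (fibre E (grng G x)) (\<pi> x (\<xi> (gdom G x))) (\<eta> (grng G x))))"

definition directed_index :: "'i set \<Rightarrow> ('i \<Rightarrow> 'i \<Rightarrow> bool) \<Rightarrow> bool" where
  "directed_index I leq \<longleftrightarrow>
     I \<noteq> {} \<and> reflp_on I leq \<and> transp_on I leq \<and>
     (\<forall>i\<in>I. \<forall>j\<in>I. \<exists>k\<in>I. leq i k \<and> leq j k)"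

definition net_to_one_on_compacts ::
    "'a topology \<Rightarrow> 'i set \<Rightarrow> ('i \<Rightarrow> 'i \<Rightarrow> bool) \<Rightarrow> ('i \<Rightarrow> 'a \<Rightarrow> 'b::real_normed_algebra_1) \<Rightarrow> bool" where
  "net_to_one_on_compacts X I leq f \<longleftrightarrow>
     (\<forall>K. compactin X K \<longrightarrow>
        (\<forall>\<epsilon>>0. \<exists>i\<in>I. \<forall>j\<in>I. leq i j \<longrightarrow> (\<forall>x\<in>K. norm (f j x - 1) < \<epsilon>)))"

definition translate ::
    "'g tgroupoid \<Rightarrow> ('g \<Rightarrow> 'h \<Rightarrow> 'h) \<Rightarrow> 'g \<Rightarrow> ('h \<Rightarrow> 'h) \<Rightarrow> 'h \<Rightarrow> 'h" where
  "translate G \<pi> x A h = \<pi> x (A (\<pi> (ginv G x) h))"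

definition amenability_net ::
    "'g tgroupoid \<Rightarrow> ('g, 'h) hilbert_bundle \<Rightarrow> ('g \<Rightarrow> 'h \<Rightarrow> 'h) \<Rightarrow>
     'i set \<Rightarrow> ('i \<Rightarrow> 'i \<Rightarrow> bool) \<Rightarrow> ('i \<Rightarrow> ('g, 'h) section_operator) \<Rightarrow> bool" where
  "amenability_net G E \<pi> I leq T \<longleftrightarrow>
     directed_index I leq \<and>
     (\<forall>i\<in>I. hilbert_schmidt (unit_space G) E (T i) \<and>
        (SUP v\<in>units G. hs_norm (fibre E v) (localization (unit_space G) E (T i) v)) \<le> 1) \<and>
     net_to_one_on_compacts (unit_space G) I leq
       (\<lambda>i v. hs_norm (fibre E v) (localization (unit_space G) E (T i) v)) \<and>
     net_to_one_on_compacts (gtop G) I leq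
       (\<lambda>i x. hs_inner (fibre E (grng G x))
          (translate G \<pi> x (localization (unit_space G) E (T i) (gdom G x)))
          (localization (unit_space G) E (T i) (grng G x)))"

text \<open>
  HOL cannot quantify over the type of indices inside a definition.  The index type used here is
  large enough for all nets, as \<open>amenable_repI\<close> shows.
\<close>

definition amenable_rep ::
    "'g tgroupoid \<Rightarrow> ('g, 'h) hilbert_bundle \<Rightarrow> ('g \<Rightarrow> 'h \<Rightarrow> 'h) \<Rightarrow> bool" where
  "amenable_rep G E \<pi> \<longleftrightarrow>
     unitary_rep G E \<pi> \<and>
     (\<exists>(I :: (('g, 'h) section_operator \<times> ('g, 'h) section_operator set) set) leq T.
        amenability_net G E \<pi> I leq T)"

lemma net_to_one_reindex:
  assumes conv: "net_to_one_on_compacts X I leq (\<lambda>i. f (T i))" and dir: "directed_index I leq"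
  shows "net_to_one_on_compacts X
    {(t, A). t \<in> A \<and> (\<exists>i\<in>I. A = T ` {j \<in> I. leq i j})} (\<lambda>p q. snd q \<subseteq> snd p) (\<lambda>p. f (fst p))"
  unfolding net_to_one_on_compacts_def
proof (intro allI impI)
  fix K and e :: real
  assume "compactin X K" "e > 0"
  then obtain i where i: "i \<in> I" "\<And>j. j \<in> I \<Longrightarrow> leq i j \<Longrightarrow> \<forall>x\<in>K. norm (f (T j) x - 1) < e"
    using conv unfolding net_to_one_on_compacts_def by meson
  have "leq i i"
    using dir i(1) by (auto simp: directed_index_def reflp_on_def)
  with i show "\<exists>p\<in>{(t, A). t \<in> A \<and> (\<exists>i\<in>I. A = T ` {j \<in> I. leq i j})}.
      \<forall>q\<in>{(t, A). t \<in> A \<and> (\<exists>i\<in>I. A = T ` {j \<in> I. leq i j})}.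
        snd q \<subseteq> snd p \<longrightarrow> (\<forall>x\<in>K. norm (f (fst q) x - 1) < e)"
    by (intro bexI[of _ "(T i, T ` {j \<in> I. leq i j})"]) fastforce+
qed

lemma amenable_repI:
  assumes "unitary_rep G E \<pi>" and net: "amenability_net G E \<pi> I leq T"
  shows "amenable_rep G E \<pi>"
proof -
  let ?I = "{(t, A). t \<in> A \<and> (\<exists>i\<in>I. A = T ` {j \<in> I. leq i j})}"
  let ?leq = "\<lambda>p q. snd q \<subseteq> snd p"
  have dir: "directed_index I leq"
    using net by (simp add: amenability_net_def)
  then have refl: "\<And>i. i \<in> I \<Longrightarrow> leq i i"
    and trans: "\<And>i j k. i \<in> I \<Longrightarrow> j \<in> I \<Longrightarrow> k \<in> I \<Longrightarrow> leq i j \<Longrightarrow> leq j k \<Longrightarrow> leq i k"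
    unfolding directed_index_def reflp_on_def transp_on_def by blast+
  have dir': "directed_index ?I ?leq"
    unfolding directed_index_def
  proof (intro conjI ballI)
    obtain i where "i \<in> I"
      using dir by (auto simp: directed_index_def)
    then have "(T i, T ` {j \<in> I. leq i j}) \<in> ?I"
      using refl by auto
    then show "?I \<noteq> {}" by blast
    show "reflp_on ?I ?leq"
      by (intro reflp_onI subset_refl)
    show "transp_on ?I ?leq"
      by (intro transp_onI) (erule (1) subset_trans)
    fix p q assume "p \<in> ?I" "q \<in> ?I"
    then obtain i j where ij: "i \<in> I" "j \<in> I"
        "snd p = T ` {k \<in> I. leq i k}" "snd q = T ` {k \<in> I. leq j k}"
      by auto
    then obtain k where k: "k \<in> I" "leq i k" "leq j k"
      using dir unfolding directed_index_def by blast
    have r: "(T k, T ` {l \<in> I. leq k l}) \<in> ?I"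
      using k refl by auto
    have "T ` {l \<in> I. leq k l} \<subseteq> snd p" "T ` {l \<in> I. leq k l} \<subseteq> snd q"
      using ij k trans by blast+
    then show "\<exists>r\<in>?I. snd p \<supseteq> snd r \<and> snd q \<supseteq> snd r"
      by (intro bexI[OF _ r]) simp
  qed
  have hs: "hilbert_schmidt (unit_space G) E (fst p) \<and>
      (SUP v\<in>units G. hs_norm (fibre E v) (localization (unit_space G) E (fst p) v)) \<le> 1"
    if "p \<in> ?I" for p
  proof -
    from that obtain i where "i \<in> I" "fst p = T i"
      by auto
    with net show ?thesis
      by (simp add: amenability_net_def)
  qed
  have norm: "net_to_one_on_compacts (unit_space G) ?I ?leq
      (\<lambda>p v. hs_norm (fibre E v) (localization (unit_space G) E (fst p) v))"
    by (rule net_to_one_reindex[where f = "\<lambda>t v. hs_norm (fibre E v)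
          (localization (unit_space G) E t v)", OF _ dir])
      (use net in \<open>simp add: amenability_net_def\<close>)
  have inner: "net_to_one_on_compacts (gtop G) ?I ?leq
      (\<lambda>p x. hs_inner (fibre E (grng G x))
        (translate G \<pi> x (localization (unit_space G) E (fst p) (gdom G x)))
        (localization (unit_space G) E (fst p) (grng G x)))"
    by (rule net_to_one_reindex[where f = "\<lambda>t x. hs_inner (fibre E (grng G x))
          (translate G \<pi> x (localization (unit_space G) E t (gdom G x)))
          (localization (unit_space G) E t (grng G x))", OF _ dir])
      (use net in \<open>simp add: amenability_net_def\<close>)
  have "amenability_net G E \<pi> ?I ?leq fst"
    unfolding amenability_net_def by (intro conjI ballI dir' hs norm inner)
  with assms(1) show ?thesis
    unfolding amenable_rep_def by (intro conjI exI)
qed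

text \<open>Unitary equivalence of the restrictions to the isotropy group at \<^term>\<open>u\<close>.  A continuous field
  over a point is just its fibre, so one unitary between the fibres at \<^term>\<open>u\<close> is involved.\<close>

definition unitarily_equivalent_at ::
    "'g tgroupoid \<Rightarrow> 'g \<Rightarrow> ('g, 'h) hilbert_bundle \<Rightarrow> ('g \<Rightarrow> 'h \<Rightarrow> 'h) \<Rightarrow>
     ('g, 'k) hilbert_bundle \<Rightarrow> ('g \<Rightarrow> 'k \<Rightarrow> 'k) \<Rightarrow> bool" where
  "unitarily_equivalent_at G u E \<pi> F \<rho> \<longleftrightarrow>
     (\<exists>U. unitary_map (fibre E u) (fibre F u) U \<and>
        (\<forall>x\<in>gset (isotropy G u). \<forall>h\<in>carrier (fibre E u). U (\<pi> x h) = \<rho> x (U h)))"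

end

theory Submission
  imports Defs
begin

text \<open>
  The section \<open>\<gamma>\<close> turns \<open>x\<close> into \<open>\<gamma>(r(x))\<inverse> x \<gamma>(d(x))\<close>, a continuous homomorphism from \<open>G\<close> to the
  isotropy group at \<open>u\<close>.  Composing it with \<open>\<pi>\<close> gives a representation \<open>\<pi>'\<close> on the constant bundle whose
  fibre is the space \<open>H\<close> of \<open>\<pi>\<close>, and \<open>\<pi>(\<gamma>(u))\<close> intertwines its restriction with \<open>\<pi>\<close>.  If \<open>A\<^sub>i\<close> is an
  amenability net for \<open>\<pi>\<close> and \<open>\<phi>\<^sub>K\<close> is a \<open>C\<^sub>0\<close> function with values in \<open>[0, 1]\<close> equal to 1 on the compact
  set \<open>K\<close>, then the operators \<open>(T \<xi>)(v) = \<phi>\<^sub>K(v) A\<^sub>i \<xi>(v)\<close>, indexed by the pairs \<open>(i, K)\<close>, form one for \<open>\<pi>'\<close>.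
\<close>

section \<open>Hilbert spaces\<close>

text \<open>The cutoffs are forced: the field that is constantly A has a constant Hilbert-Schmidt
  norm, which does not vanish at infinity unless the unit space is compact or that norm is 0. They
  are harmless in the limit: once K contains the domains and ranges of a compact set of arrows, both
  cutoff factors are 1 there, and the inner product is that of \<pi> at the images of these arrows,
  which form a compact subset of the isotropy group. Two obstacles shape the rest. An adjointable
  operator is given only by the existence of an adjoint, so linearity and boundedness of the A_i, on
  which the continuity of v -> A_i \<xi>(v) rests, have to be derived. And the C_0 sections of the
  constant bundle must be shown to be countably generated, by an approximation with continuous
  weights; second countability enters there. The intertwiner is needed because \<gamma>(u) may
  differ from the unit u: on the isotropy group the homomorphism is a conjugation.\<close>

lemma complex_ring_simps [simp]:
  "carrier complex_ring = UNIV" "a \<oplus>\<^bsub>complex_ring\<^esub> b = a + b" "a \<otimes>\<^bsub>complex_ring\<^esub> b = a * b"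
  "\<one>\<^bsub>complex_ring\<^esub> = 1" "\<zero>\<^bsub>complex_ring\<^esub> = 0"
  by (simp_all add: complex_ring_def)

locale hilbert =
  fixes H :: "'h hilb" (structure)
  assumes hilbert: "hilbert_space H"
begin

abbreviation ip :: "'h \<Rightarrow> 'h \<Rightarrow> complex" where "ip \<equiv> hinner H"
abbreviation nrm :: "'h \<Rightarrow> real" where "nrm \<equiv> hnorm H"

lemma module: "module complex_ring H"
  using hilbert by (simp add: hilbert_space_def)

sublocale abelian_group H
  using module by (rule module.axioms)

lemma smult_closed [simp, intro]: "x \<in> carrier H \<Longrightarrow> a \<odot> x \<in> carrier H"
  using module.smult_closed[OF module] by simp

lemma smult_add_left: "x \<in> carrier H \<Longrightarrow> (a + b) \<odot> x = a \<odot> x \<oplus> b \<odot> x"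
  using module.smult_l_distr[OF module, of a b x] by simp

lemma smult_add_right:
  "x \<in> carrier H \<Longrightarrow> y \<in> carrier H \<Longrightarrow> a \<odot> (x \<oplus> y) = a \<odot> x \<oplus> a \<odot> y"
  using module.smult_r_distr[OF module, of a x y] by simp

lemma smult_smult: "x \<in> carrier H \<Longrightarrow> a \<odot> (b \<odot> x) = (a * b) \<odot> x"
  using module.smult_assoc1[OF module, of a b x] by simp

lemma smult_one [simp]: "x \<in> carrier H \<Longrightarrow> 1 \<odot> x = x"
  using module.smult_one[OF module, of x] by simp

lemma smult_zero [simp]: "x \<in> carrier H \<Longrightarrow> 0 \<odot> x = \<zero>"
  using module.smult_l_null[OF module, of x] by simp

lemma smult_zero_right [simp]: "a \<odot> \<zero> = \<zero>"
  using module.smult_r_null[OF module, of a] by simp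

lemma ip_add_left:
  "x \<in> carrier H \<Longrightarrow> y \<in> carrier H \<Longrightarrow> z \<in> carrier H \<Longrightarrow> ip (x \<oplus> y) z = ip x z + ip y z"
  using hilbert unfolding hilbert_space_def by blast

lemma ip_smult_left: "x \<in> carrier H \<Longrightarrow> y \<in> carrier H \<Longrightarrow> ip (a \<odot> x) y = a * ip x y"
  using hilbert unfolding hilbert_space_def by blast

lemma ip_commute: "x \<in> carrier H \<Longrightarrow> y \<in> carrier H \<Longrightarrow> ip y x = cnj (ip x y)"
  using hilbert unfolding hilbert_space_def by blast

lemma ip_nonneg: "x \<in> carrier H \<Longrightarrow> 0 \<le> Re (ip x x)"
  using hilbert unfolding hilbert_space_def by blast

lemma ip_definite: "x \<in> carrier H \<Longrightarrow> ip x x = 0 \<Longrightarrow> x = \<zero>"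
  using hilbert unfolding hilbert_space_def by blast

lemma ip_add_right:
  assumes "x \<in> carrier H" "y \<in> carrier H" "z \<in> carrier H"
  shows "ip z (x \<oplus> y) = ip z x + ip z y"
  using assms ip_add_left[OF assms] ip_commute[of _ z] by simp

lemma ip_smult_right:
  assumes "x \<in> carrier H" "y \<in> carrier H"
  shows "ip y (a \<odot> x) = cnj a * ip y x"
  using assms ip_smult_left[OF assms] ip_commute[of _ y] by simp

lemma ip_zero_left [simp]: "x \<in> carrier H \<Longrightarrow> ip \<zero> x = 0"
  using ip_smult_left[of \<zero> x 0] by simp

lemma ip_zero_right [simp]: "x \<in> carrier H \<Longrightarrow> ip x \<zero> = 0"
  using ip_commute[of \<zero> x] by simp

text \<open>The inner product laws and \<open>unitary_map\<close> speak of sums and scalar multiples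
  only; in this form a difference is covered by both.\<close>

lemma minus_eq_smult:
  assumes "x \<in> carrier H" "y \<in> carrier H"
  shows "x \<ominus> y = x \<oplus> (-1) \<odot> y"
proof -
  have "y \<oplus> (-1) \<odot> y = \<zero>"
    using smult_add_left[of y 1 "-1"] assms by simp
  then have "\<ominus> y = (-1) \<odot> y"
    using assms minus_equality[of "(-1) \<odot> y" y] a_comm[of y "(-1) \<odot> y"] by simp
  then show ?thesis by (simp add: a_minus_def)
qed

lemma ip_minus_left:
  "x \<in> carrier H \<Longrightarrow> y \<in> carrier H \<Longrightarrow> z \<in> carrier H \<Longrightarrow> ip (x \<ominus> y) z = ip x z - ip y z"
  by (simp add: minus_eq_smult ip_add_left ip_smult_left)

lemma ip_minus_right:
  "x \<in> carrier H \<Longrightarrow> y \<in> carrier H \<Longrightarrow> z \<in> carrier H \<Longrightarrow> ip z (x \<ominus> y) = ip z x - ip z y"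
  by (simp add: minus_eq_smult ip_add_right ip_smult_right)

lemma smult_minus_right:
  "x \<in> carrier H \<Longrightarrow> y \<in> carrier H \<Longrightarrow> a \<odot> (x \<ominus> y) = a \<odot> x \<ominus> a \<odot> y"
  by (simp add: minus_eq_smult smult_add_right smult_smult mult.commute)

lemma minus_eq_zero_iff:
  assumes "x \<in> carrier H" "y \<in> carrier H"
  shows "x \<ominus> y = \<zero> \<longleftrightarrow> x = y"
  using assms by (metis a_minus_def minus_closed minus_equality minus_minus r_neg a_inv_closed)

lemma ip_self: "x \<in> carrier H \<Longrightarrow> ip x x = complex_of_real ((nrm x)\<^sup>2)"
  using ip_commute[of x x] ip_nonneg[of x] by (simp add: hnorm_def complex_eq_iff)

lemma nrm_nonneg [simp]: "x \<in> carrier H \<Longrightarrow> 0 \<le> nrm x"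
  by (simp add: hnorm_def ip_nonneg)

lemma nrm_zero [simp]: "nrm \<zero> = 0"
  by (simp add: hnorm_def)

lemma nrm_eq_zero_iff: "x \<in> carrier H \<Longrightarrow> nrm x = 0 \<longleftrightarrow> x = \<zero>"
  using ip_definite[of x] ip_self[of x] by auto

lemma nrm_smult [simp]: "x \<in> carrier H \<Longrightarrow> nrm (a \<odot> x) = norm a * nrm x"
proof -
  assume x: "x \<in> carrier H"
  have "complex_of_real ((nrm (a \<odot> x))\<^sup>2) = ip (a \<odot> x) (a \<odot> x)"
    using x by (simp only: ip_self smult_closed)
  also have "\<dots> = a * cnj a * complex_of_real ((nrm x)\<^sup>2)"
    using x by (simp add: ip_smult_left ip_smult_right del: of_real_power flip: ip_self)
  also have "\<dots> = complex_of_real ((norm a * nrm x)\<^sup>2)"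
    by (simp only: complex_norm_square power_mult_distrib of_real_mult)
  finally have "(nrm (a \<odot> x))\<^sup>2 = (norm a * nrm x)\<^sup>2"
    by (simp only: of_real_eq_iff)
  then show ?thesis
    using x by (simp only: power2_eq_iff_nonneg nrm_nonneg smult_closed norm_ge_zero mult_nonneg_nonneg)
qed

lemma nrm_add_sq:
  assumes "x \<in> carrier H" "y \<in> carrier H"
  shows "(nrm (x \<oplus> y))\<^sup>2 = (nrm x)\<^sup>2 + 2 * Re (ip x y) + (nrm y)\<^sup>2"
proof -
  have "complex_of_real ((nrm (x \<oplus> y))\<^sup>2) = ip x x + ip y y + (ip x y + cnj (ip x y))"
    using assms by (simp only: ip_self[symmetric] a_closed) (simp add: ip_add_left ip_add_right ip_commute[of x y])
  then show ?thesis
    using assms by (simp add: ip_self complex_add_cnj complex_eq_iff)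
qed

section \<open>Cauchy-Schwarz and the metric of the norm\<close>

lemma cauchy_schwarz:
  assumes x: "x \<in> carrier H" and y: "y \<in> carrier H"
  shows "norm (ip x y) \<le> nrm x * nrm y"
proof (cases "nrm y = 0")
  case True
  then show ?thesis using x y by (simp add: nrm_eq_zero_iff)
next
  case False
  \<comment> \<open>This c minimises the norm of x + c y; that the minimum is nonnegative is the
    inequality.\<close>
  define c where "c = - ip x y / complex_of_real ((nrm y)\<^sup>2)"
  have "Re (ip x (c \<odot> y)) = - (norm (ip x y))\<^sup>2 / (nrm y)\<^sup>2"
    using x y by (simp add: ip_smult_right c_def complex_norm_square[symmetric] mult.commute
        Re_divide_of_real flip: of_real_power)
  moreover have "(nrm (c \<odot> y))\<^sup>2 = (norm (ip x y))\<^sup>2 / (nrm y)\<^sup>2"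
    using False y by (simp add: c_def norm_divide field_simps power2_eq_square norm_mult)
  ultimately have "0 \<le> (nrm x)\<^sup>2 - (norm (ip x y))\<^sup>2 / (nrm y)\<^sup>2"
    using nrm_add_sq[OF x smult_closed[OF y, of c]] zero_le_power2[of "nrm (x \<oplus> c \<odot> y)"] by simp
  then have "(norm (ip x y))\<^sup>2 \<le> (nrm x * nrm y)\<^sup>2"
    using False by (simp add: field_simps power_mult_distrib)
  then show ?thesis
    by (rule power2_le_imp_le) (use x y in simp)
qed

lemma nrm_triangle:
  assumes x: "x \<in> carrier H" and y: "y \<in> carrier H"
  shows "nrm (x \<oplus> y) \<le> nrm x + nrm y"
proof (rule power2_le_imp_le)
  have "Re (ip x y) \<le> nrm x * nrm y"
    using cauchy_schwarz[OF assms] complex_Re_le_cmod order_trans by blast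
  then show "(nrm (x \<oplus> y))\<^sup>2 \<le> (nrm x + nrm y)\<^sup>2"
    using nrm_add_sq[OF assms] by (simp add: power2_sum)
qed (use x y in simp)

lemma hdist_eq: "x \<in> carrier H \<Longrightarrow> y \<in> carrier H \<Longrightarrow> hdist H x y = nrm (x \<ominus> y)"
  by (simp add: hdist_def)

lemma minus_smult_swap:
  assumes "x \<in> carrier H" "y \<in> carrier H"
  shows "y \<ominus> x = (-1) \<odot> (x \<ominus> y)"
  using assms by (simp add: minus_eq_smult smult_add_right smult_smult a_comm)

lemma minus_add_cancel_middle:
  assumes "x \<in> carrier H" "y \<in> carrier H" "z \<in> carrier H"
  shows "x \<ominus> z = (x \<ominus> y) \<oplus> (y \<ominus> z)"
  using assms by (simp add: a_minus_def a_assoc) (simp add: a_assoc[symmetric] l_neg)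

lemma add_minus_add:
  assumes "x \<in> carrier H" "y \<in> carrier H" "x' \<in> carrier H" "y' \<in> carrier H"
  shows "(x \<oplus> y) \<ominus> (x' \<oplus> y') = (x \<ominus> x') \<oplus> (y \<ominus> y')"
  using assms by (simp add: a_minus_def minus_add a_ac)

sublocale Metric_space "carrier H" "hdist H"
proof
  show "0 \<le> hdist H x y" for x y
    by (simp add: hdist_def)
  show "hdist H x y = hdist H y x" for x y
    using minus_smult_swap[of x y] by (simp add: hdist_def)
  show "hdist H x y = 0 \<longleftrightarrow> x = y" if "x \<in> carrier H" "y \<in> carrier H" for x y
    using that by (simp add: hdist_eq nrm_eq_zero_iff minus_eq_zero_iff)
  show "hdist H x z \<le> hdist H x y + hdist H y z"
    if "x \<in> carrier H" "y \<in> carrier H" "z \<in> carrier H" for x y z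
    using that nrm_triangle[of "x \<ominus> y" "y \<ominus> z"]
    by (simp add: hdist_eq minus_add_cancel_middle[of x y z])
qed

lemma complete: "mcomplete"
  using hilbert by (simp add: hilbert_space_def)

lemma hdist_zero: "x \<in> carrier H \<Longrightarrow> hdist H x \<zero> = nrm x"
  by (simp add: hdist_eq minus_eq_smult)

text \<open>The norm is the distance from \<open>\<zero>\<close>, so the reverse triangle inequality
  of the metric applies.\<close>

lemma abs_nrm_diff_le:
  assumes "x \<in> carrier H" "y \<in> carrier H"
  shows "\<bar>nrm x - nrm y\<bar> \<le> hdist H x y"
  using triangle[of x y \<zero>] triangle[of y x \<zero>] assms commute[of x y] by (simp add: hdist_zero)

lemma hdist_add_le:
  assumes "x \<in> carrier H" "y \<in> carrier H" "x' \<in> carrier H" "y' \<in> carrier H"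
  shows "hdist H (x \<oplus> y) (x' \<oplus> y') \<le> hdist H x x' + hdist H y y'"
  using assms nrm_triangle[of "x \<ominus> x'" "y \<ominus> y'"] by (simp add: hdist_eq add_minus_add)

lemma hdist_smult:
  assumes "x \<in> carrier H" "y \<in> carrier H"
  shows "hdist H (a \<odot> x) (a \<odot> y) = norm a * hdist H x y"
  using assms by (simp add: hdist_eq flip: smult_minus_right)

lemma hdist_smult_left:
  assumes "x \<in> carrier H"
  shows "hdist H (a \<odot> x) (b \<odot> x) = norm (a - b) * nrm x"
proof -
  have "a \<odot> x \<ominus> b \<odot> x = (a - b) \<odot> x"
    using assms smult_add_left[of x a "-b"] by (simp add: minus_eq_smult smult_smult)
  then show ?thesis
    using assms by (simp add: hdist_eq)
qed

lemma eqI_ip: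
  assumes "x \<in> carrier H" "y \<in> carrier H" "\<And>z. z \<in> carrier H \<Longrightarrow> ip z x = ip z y"
  shows "x = y"
proof -
  have "ip (x \<ominus> y) (x \<ominus> y) = 0"
    using assms by (subst ip_minus_right) auto
  then show ?thesis
    using assms ip_definite[of "x \<ominus> y"] by (simp add: minus_eq_zero_iff)
qed

section \<open>Continuity of maps into a Hilbert space\<close>

lemma continuous_iff:
  "continuous_map X (htopology H) f \<longleftrightarrow>
    (\<forall>x\<in>topspace X. f x \<in> carrier H) \<and>
    (\<forall>x\<in>topspace X. ((\<lambda>y. hdist H (f y) (f x)) \<longlongrightarrow> 0) (atin X x))"
proof -
  have "\<forall>\<^sub>F y in atin X x. f y \<in> carrier H" if "\<forall>x\<in>topspace X. f x \<in> carrier H" for x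
    using that by (auto simp: eventually_atin)
  then show ?thesis
    unfolding continuous_map_atin limitin_metric_dist_null by blast
qed

lemma continuous_const: "h \<in> carrier H \<Longrightarrow> continuous_map X (htopology H) (\<lambda>_. h)"
  by simp

text \<open>The pattern of the continuity proofs that follow: the distance to the limit is bounded
  by a real function that tends to 0 (\<open>tendsto_0_le\<close> with factor 1). The bound holds on
  the whole space, so \<open>topspace X\<close> serves as the neighbourhood in
  \<open>eventually_atin\<close>.\<close>

lemma continuous_add:
  assumes "continuous_map X (htopology H) f" "continuous_map X (htopology H) g"
  shows "continuous_map X (htopology H) (\<lambda>x. f x \<oplus> g x)"
  unfolding continuous_iff
proof (intro conjI ballI)
  have car: "\<And>x. x \<in> topspace X \<Longrightarrow> f x \<in> carrier H \<and> g x \<in> carrier H"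
    using assms by (auto simp: continuous_iff)
  then show "\<And>x. x \<in> topspace X \<Longrightarrow> f x \<oplus> g x \<in> carrier H"
    by simp
  fix x assume x: "x \<in> topspace X"
  show "((\<lambda>y. hdist H (f y \<oplus> g y) (f x \<oplus> g x)) \<longlongrightarrow> 0) (atin X x)"
  proof (rule tendsto_0_le[where K = 1])
    show "((\<lambda>y. hdist H (f y) (f x) + hdist H (g y) (g x)) \<longlongrightarrow> 0) (atin X x)"
      using assms x by (intro tendsto_add_zero) (auto simp: continuous_iff)
    show "\<forall>\<^sub>F y in atin X x. norm (hdist H (f y \<oplus> g y) (f x \<oplus> g x))
        \<le> norm (hdist H (f y) (f x) + hdist H (g y) (g x)) * 1"
      unfolding eventually_atin using car x by (auto intro!: exI[of _ "topspace X"] hdist_add_le)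
  qed
qed

lemma continuous_nrm:
  assumes "continuous_map X (htopology H) f"
  shows "continuous_map X euclideanreal (\<lambda>x. nrm (f x))"
  unfolding continuous_map_atin limitin_canonical_iff
proof
  fix x assume x: "x \<in> topspace X"
  show "((\<lambda>x. nrm (f x)) \<longlongrightarrow> nrm (f x)) (atin X x)"
  proof (rule LIM_zero_cancel, rule tendsto_0_le[where K = 1])
    show "((\<lambda>y. hdist H (f y) (f x)) \<longlongrightarrow> 0) (atin X x)"
      using assms x by (auto simp: continuous_iff)
    show "\<forall>\<^sub>F y in atin X x. norm (nrm (f y) - nrm (f x)) \<le> norm (hdist H (f y) (f x)) * 1"
      unfolding eventually_atin using assms x
      by (auto simp: continuous_iff intro!: exI[of _ "topspace X"] abs_nrm_diff_le)
  qed
qed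

lemma continuous_dist_const:
  assumes "continuous_map X (htopology H) f" "h \<in> carrier H"
  shows "continuous_map X euclideanreal (\<lambda>x. hdist H (f x) h)"
proof (rule continuous_map_eq)
  show "continuous_map X euclideanreal (\<lambda>x. nrm (f x \<oplus> (-1) \<odot> h))"
    by (intro continuous_nrm continuous_add assms continuous_const) (use assms in simp)
  show "nrm (f x \<oplus> (-1) \<odot> h) = hdist H (f x) h" if "x \<in> topspace X" for x
    using that assms by (auto simp: continuous_iff hdist_eq minus_eq_smult)
qed

lemma continuous_smult:
  assumes a: "continuous_map X euclidean a" and f: "continuous_map X (htopology H) f"
  shows "continuous_map X (htopology H) (\<lambda>x. a x \<odot> f x)"
  unfolding continuous_iff
proof (intro conjI ballI)
  have car: "\<And>x. x \<in> topspace X \<Longrightarrow> f x \<in> carrier H"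
    using f by (auto simp: continuous_iff)
  then show "\<And>x. x \<in> topspace X \<Longrightarrow> a x \<odot> f x \<in> carrier H"
    by simp
  fix x assume x: "x \<in> topspace X"
  have ax: "(a \<longlongrightarrow> a x) (atin X x)"
    using a x by (simp add: continuous_map_atin)
  show "((\<lambda>y. hdist H (a y \<odot> f y) (a x \<odot> f x)) \<longlongrightarrow> 0) (atin X x)"
  proof (rule tendsto_0_le[where K = 1])
    \<comment> \<open>The estimate passes through the vector a(y) f(x): the first summand moves f,
      the second moves a.\<close>
    have "((\<lambda>y. norm (a y) * hdist H (f y) (f x) + norm (a y - a x) * nrm (f x)) \<longlongrightarrow>
        norm (a x) * 0 + norm (a x - a x) * nrm (f x)) (atin X x)"
      using f x by (intro tendsto_intros ax) (auto simp: continuous_iff)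
    then show "((\<lambda>y. norm (a y) * hdist H (f y) (f x) + norm (a y - a x) * nrm (f x)) \<longlongrightarrow> 0)
        (atin X x)"
      by simp
    have "hdist H (a y \<odot> f y) (a x \<odot> f x)
        \<le> norm (a y) * hdist H (f y) (f x) + norm (a y - a x) * nrm (f x)"
      if "y \<in> topspace X" for y
      using triangle[of "a y \<odot> f y" "a y \<odot> f x" "a x \<odot> f x"] car[OF that] car[OF x]
      by (simp add: hdist_smult hdist_smult_left)
    then show "\<forall>\<^sub>F y in atin X x. norm (hdist H (a y \<odot> f y) (a x \<odot> f x))
        \<le> norm (norm (a y) * hdist H (f y) (f x) + norm (a y - a x) * nrm (f x)) * 1"
      unfolding eventually_atin using car x by (auto intro!: exI[of _ "topspace X"])
  qed
qed

lemma continuous_lipschitz: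
  assumes f: "continuous_map X (htopology H) f"
    and A: "\<And>x. x \<in> carrier H \<Longrightarrow> A x \<in> carrier H"
    and C: "\<And>x y. x \<in> carrier H \<Longrightarrow> y \<in> carrier H \<Longrightarrow> hdist H (A x) (A y) \<le> C * hdist H x y"
  shows "continuous_map X (htopology H) (\<lambda>x. A (f x))"
  unfolding continuous_iff
proof (intro conjI ballI)
  have car: "\<And>x. x \<in> topspace X \<Longrightarrow> f x \<in> carrier H"
    using f by (auto simp: continuous_iff)
  then show "\<And>x. x \<in> topspace X \<Longrightarrow> A (f x) \<in> carrier H"
    using A by simp
  fix x assume x: "x \<in> topspace X"
  show "((\<lambda>y. hdist H (A (f y)) (A (f x))) \<longlongrightarrow> 0) (atin X x)"
  proof (rule tendsto_0_le[where K = 1])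
    show "((\<lambda>y. C * hdist H (f y) (f x)) \<longlongrightarrow> 0) (atin X x)"
      using f x by (intro tendsto_mult_right_zero) (auto simp: continuous_iff)
    show "\<forall>\<^sub>F y in atin X x. norm (hdist H (A (f y)) (A (f x))) \<le> norm (C * hdist H (f y) (f x)) * 1"
      unfolding eventually_atin using car x
      by (auto intro!: exI[of _ "topspace X"] order_trans[OF C])
  qed
qed


lemma ip_diff_le:
  assumes "x \<in> carrier H" "y \<in> carrier H" "z \<in> carrier H"
  shows "norm (ip x z - ip y z) \<le> hdist H x y * nrm z"
  using assms cauchy_schwarz[of "x \<ominus> y" z] by (simp add: hdist_eq ip_minus_left)

lemma continuous_ip_const:
  assumes f: "continuous_map X (htopology H) f" and z: "z \<in> carrier H"
  shows "continuous_map X euclidean (\<lambda>x. ip (f x) z)"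
  unfolding continuous_map_atin limitin_canonical_iff
proof
  fix x assume x: "x \<in> topspace X"
  show "((\<lambda>x. ip (f x) z) \<longlongrightarrow> ip (f x) z) (atin X x)"
  proof (rule LIM_zero_cancel, rule tendsto_0_le[where K = 1])
    show "((\<lambda>y. hdist H (f y) (f x) * nrm z) \<longlongrightarrow> 0) (atin X x)"
      using assms x by (intro tendsto_mult_left_zero) (auto simp: continuous_iff)
    show "\<forall>\<^sub>F y in atin X x. norm (ip (f y) z - ip (f x) z) \<le> norm (hdist H (f y) (f x) * nrm z) * 1"
      unfolding eventually_atin using assms x
      by (auto simp: continuous_iff abs_mult intro!: exI[of _ "topspace X"] ip_diff_le)
  qed
qed

section \<open>Orthonormal bases\<close>

lemma ex_orthonormal_basis: "\<exists>B. orthonormal_basis H B"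
proof -
  let ?A = "{B. B \<subseteq> carrier H \<and> (\<forall>e\<in>B. \<forall>f\<in>B. ip e f = (if e = f then 1 else 0))}"
  \<comment> \<open>Zorn's lemma applies because any two vectors from a chain lie in a common
    member, so its union is orthonormal.\<close>
  have "\<exists>B\<in>?A. \<forall>C\<in>?A. B \<subseteq> C \<longrightarrow> C = B"
  proof (rule subset_Zorn_nonempty)
    show "?A \<noteq> {}" by (auto intro: exI[of _ "{}"])
    fix \<C> assume ne: "\<C> \<noteq> {}" and ch: "subset.chain ?A \<C>"
    have sub: "\<C> \<subseteq> ?A" and tot: "\<And>B C. B \<in> \<C> \<Longrightarrow> C \<in> \<C> \<Longrightarrow> B \<subseteq> C \<or> C \<subseteq> B"
      using ch by (auto simp: subset_chain_def)
    have "ip e f = (if e = f then 1 else 0)" if e: "e \<in> \<Union>\<C>" and f: "f \<in> \<Union>\<C>" for e f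
    proof -
      from e f obtain B C where "B \<in> \<C>" "C \<in> \<C>" "e \<in> B" "f \<in> C" by blast
      with tot[of B C] obtain D where "D \<in> \<C>" "e \<in> D" "f \<in> D" by blast
      with sub show ?thesis by blast
    qed
    moreover have "\<Union>\<C> \<subseteq> carrier H"
      using sub by blast
    ultimately show "\<Union>\<C> \<in> ?A" by simp
  qed
  then obtain B where B: "B \<subseteq> carrier H" "\<And>e f. e \<in> B \<Longrightarrow> f \<in> B \<Longrightarrow> ip e f = (if e = f then 1 else 0)"
    and max: "\<And>C. C \<in> ?A \<Longrightarrow> B \<subseteq> C \<Longrightarrow> C = B"
    by auto
  have "x = \<zero>" if x: "x \<in> carrier H" and orth: "\<And>e. e \<in> B \<Longrightarrow> ip x e = 0" for x
  proof (rule ccontr)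
    assume "x \<noteq> \<zero>"
    then have nz: "nrm x \<noteq> 0"
      using x by (simp add: nrm_eq_zero_iff)
    \<comment> \<open>A nonzero vector orthogonal to B could be normalised and added to B, against
      maximality.\<close>
    define y where "y = complex_of_real (1 / nrm x) \<odot> x"
    have y: "y \<in> carrier H"
      using x by (simp add: y_def)
    have "nrm y = 1"
      using x nz by (simp add: y_def norm_divide)
    then have yy: "ip y y = 1"
      using ip_self[OF y] by simp
    have ye: "ip y e = 0" "ip e y = 0" if "e \<in> B" for e
      using that x B(1) orth[OF that] ip_commute[of x e]
      by (auto simp: y_def ip_smult_left ip_smult_right)
    then have "y \<notin> B"
      using yy by force
    then have "insert y B \<in> ?A"
      using y yy ye B by auto
    then show False
      using max[of "insert y B"] \<open>y \<notin> B\<close> by auto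
  qed
  then have "orthonormal_basis H B"
    unfolding orthonormal_basis_def using B by (intro conjI ballI impI) simp_all
  then show ?thesis ..
qed

text \<open>\<open>onb H\<close> is a \<open>SOME\<close> choice, so what is said of it rests on the
  existence of a basis. Lying in the carrier is the property that the trace computations
  use.\<close>

lemma onb_subset: "onb H \<subseteq> carrier H"
  using someI_ex[OF ex_orthonormal_basis] unfolding onb_def orthonormal_basis_def by blast

text \<open>What adjointability of an operator on sections leaves on a single fibre. Linearity and
  boundedness are consequences: \<open>adjoint_smult\<close>, \<open>adjoint_minus\<close>,
  \<open>adjoint_bounded\<close>. With B at hand, the \<open>THE\<close> in \<open>hadjoint\<close>
  is identified without the Riesz representation theorem.\<close>

definition mutually_adjoint :: "('h \<Rightarrow> 'h) \<Rightarrow> ('h \<Rightarrow> 'h) \<Rightarrow> bool" where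
  "mutually_adjoint A B \<longleftrightarrow>
    (\<forall>x\<in>carrier H. A x \<in> carrier H \<and> B x \<in> carrier H) \<and>
    (\<forall>x\<in>carrier H. \<forall>y\<in>carrier H. ip (A x) y = ip x (B y))"

lemma mutually_adjoint_sym:
  assumes "mutually_adjoint A B"
  shows "mutually_adjoint B A"
  using assms ip_commute unfolding mutually_adjoint_def by metis

lemma mutually_adjointD:
  assumes "mutually_adjoint A B"
  shows "x \<in> carrier H \<Longrightarrow> A x \<in> carrier H" "x \<in> carrier H \<Longrightarrow> B x \<in> carrier H"
    "x \<in> carrier H \<Longrightarrow> y \<in> carrier H \<Longrightarrow> ip (A x) y = ip x (B y)"
    "x \<in> carrier H \<Longrightarrow> y \<in> carrier H \<Longrightarrow> ip y (A x) = ip (B y) x"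
  using assms mutually_adjoint_sym[OF assms] by (auto simp: mutually_adjoint_def)

text \<open>Both sides have the same inner product with every z: moving A over to z leaves an inner
  product in which the scalar comes out. \<open>adjoint_minus\<close> holds for the same
  reason.\<close>

lemma adjoint_smult:
  assumes "mutually_adjoint A B" "x \<in> carrier H"
  shows "A (c \<odot> x) = c \<odot> A x"
  by (rule eqI_ip) (use assms in \<open>auto simp: mutually_adjointD[OF assms(1)] ip_smult_right\<close>)

lemma adjoint_minus:
  assumes "mutually_adjoint A B" "x \<in> carrier H" "y \<in> carrier H"
  shows "A (x \<ominus> y) = A x \<ominus> A y"
  by (rule eqI_ip) (use assms in \<open>auto simp: mutually_adjointD[OF assms(1)] ip_minus_right\<close>)

text \<open>Since \<open>A\<close> has an adjoint, each set \<open>{x. \<parallel>A x\<parallel> \<le> n}\<close> is closed, and the Baire category theorem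
  makes one of them a neighbourhood of some point.\<close>

lemma adjoint_bounded:
  assumes AB: "mutually_adjoint A B"
  obtains C where "\<And>x. x \<in> carrier H \<Longrightarrow> nrm (A x) \<le> C * nrm x"
proof -
  note AB' = mutually_adjointD[OF AB]
  \<comment> \<open>The bound on \<open>A x\<close> is phrased through B, so that every y
    contributes a condition that is continuous in x.\<close>
  define E where "E n = {x \<in> carrier H. \<forall>y\<in>carrier H. norm (ip x (B y)) \<le> real n * nrm y}" for n
  have closed: "closedin mtopology (E n)" for n
  proof -
    have "E n = (\<Inter>y\<in>carrier H. {x \<in> topspace mtopology. norm (ip x (B y)) \<in> {..real n * nrm y}})"
      unfolding E_def by (auto dest: bspec[OF _ zero_closed])
    moreover have "closedin mtopology {x \<in> topspace mtopology. norm (ip x (B y)) \<in> {..real n * nrm y}}"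
      if "y \<in> carrier H" for y
      by (rule closedin_continuous_map_preimage[where Y = euclideanreal],
          rule continuous_map_norm, rule continuous_ip_const)
        (use that AB' in auto)
    ultimately show ?thesis
      by (simp only:) (rule closedin_INT, use zero_closed in blast, blast)
  qed
  have bound: "nrm (A x) \<le> real n" if "x \<in> E n" for x n
  proof -
    have x: "x \<in> carrier H" using that by (simp add: E_def)
    \<comment> \<open>The condition in \<open>E n\<close> for y = \<open>A x\<close>.\<close>
    have "norm (ip (A x) (A x)) \<le> real n * nrm (A x)"
      using that x AB'(1)[OF x] by (simp add: E_def AB'(3))
    then have "nrm (A x) * nrm (A x) \<le> real n * nrm (A x)"
      using x AB' by (simp add: ip_self power2_eq_square norm_mult)
    then show ?thesis
      using x AB'(1)[OF x] nrm_nonneg[of "A x"] mult_right_le_imp_le[of "nrm (A x)" "nrm (A x)" "real n"]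
      by (cases "nrm (A x) = 0") (auto simp: less_le)
  qed
  have union: "(\<Union>n. E n) = carrier H"
  proof -
    have "\<exists>n. x \<in> E n" if x: "x \<in> carrier H" for x
    proof -
      obtain n where n: "nrm (A x) \<le> real n" using real_arch_simple by blast
      have "norm (ip x (B y)) \<le> real n * nrm y" if y: "y \<in> carrier H" for y
      proof -
        have "norm (ip x (B y)) \<le> nrm (A x) * nrm y"
          using cauchy_schwarz[of "A x" y] x y AB' by simp
        also have "\<dots> \<le> real n * nrm y"
          using n y by (intro mult_right_mono) auto
        finally show ?thesis .
      qed
      with x show ?thesis unfolding E_def by blast
    qed
    then show ?thesis by (auto simp: E_def)
  qed
  have "\<exists>n. mtopology interior_of (E n) \<noteq> {}"
  proof (rule ccontr)
    assume "\<not> ?thesis"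
    \<comment> \<open>If all interiors were empty, the whole space would have empty interior,
      although it contains \<open>\<zero>\<close>.\<close>
    then have "mtopology interior_of \<Union>(range E) = {}"
      using closed by (intro metric_Baire_category_alt[OF complete]) auto
    then have "carrier H = {}"
      using union interior_of_topspace[of mtopology] by simp
    then show False using zero_closed by blast
  qed
  then obtain n x0 where "x0 \<in> mtopology interior_of (E n)" by blast
  then obtain r where x0: "x0 \<in> carrier H" and r: "r > 0" and ball: "mball x0 r \<subseteq> E n"
    using openin_interior_of[of mtopology "E n"] interior_of_subset[of mtopology "E n"]
    unfolding openin_mtopology by blast
  have "nrm (A x) \<le> (4 * real n / r) * nrm x" if x: "x \<in> carrier H" for x
  proof (cases "nrm x = 0")
    case True
    then have "x = 0 \<odot> x"
      using x by (simp add: nrm_eq_zero_iff)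
    then have "A x = 0 \<odot> A x"
      using adjoint_smult[OF AB x, of 0] by metis
    then show ?thesis
      using True x AB' by (metis nrm_smult norm_zero mult_zero_left mult_zero_right order_refl)
  next
    case False
    then have pos: "nrm x > 0" using x nrm_nonneg[of x] by linarith
    \<comment> \<open>This scale puts z at distance r / 2 from x0. Then \<open>A z\<close> and
      \<open>A x0\<close> have norm at most n, so t times the norm of \<open>A x\<close> is at most
      2 n, whence the constant 4 n / r.\<close>
    define t where "t = r / (2 * nrm x)"
    define z where "z = x0 \<oplus> complex_of_real t \<odot> x"
    have t: "t > 0" using pos r by (simp add: t_def)
    have z: "z \<in> carrier H" using x x0 by (simp add: z_def)
    have zx: "z \<ominus> x0 = complex_of_real t \<odot> x"
      using x x0 unfolding z_def a_minus_def by (metis a_comm a_inv_closed l_neg r_zero a_assoc smult_closed)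
    have "hdist H x0 z < r"
      using x x0 z zx t pos r by (subst commute) (simp add: hdist_eq t_def norm_divide norm_mult)
    then have "nrm (A z) \<le> n" "nrm (A x0) \<le> n"
      using ball z x0 r by (auto intro!: bound simp: subset_iff)
    moreover have "nrm (A z \<ominus> A x0) \<le> nrm (A z) + nrm (A x0)"
      using triangle[of "A z" \<zero> "A x0"] z x0 AB'(1) commute[of \<zero> "A x0"]
      by (simp add: hdist_zero flip: hdist_eq)
    moreover have "A z \<ominus> A x0 = complex_of_real t \<odot> A x"
      using adjoint_minus[OF AB z x0] adjoint_smult[OF AB x] zx by metis
    ultimately have "t * nrm (A x) \<le> 2 * real n"
      using x AB' t by simp
    then have "nrm (A x) \<le> 2 * real n / t"
      using t by (simp add: field_simps)
    then show ?thesis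
      using pos r by (simp add: t_def field_simps)
  qed
  then show thesis by (rule that)
qed

lemma adjoint_lipschitz:
  assumes AB: "mutually_adjoint A B"
  obtains C where "\<And>x y. x \<in> carrier H \<Longrightarrow> y \<in> carrier H \<Longrightarrow> hdist H (A x) (A y) \<le> C * hdist H x y"
proof -
  obtain C where C: "\<And>x. x \<in> carrier H \<Longrightarrow> nrm (A x) \<le> C * nrm x"
    using adjoint_bounded[OF AB] by blast
  have "hdist H (A x) (A y) \<le> C * hdist H x y" if "x \<in> carrier H" "y \<in> carrier H" for x y
    using that C[of "x \<ominus> y"] mutually_adjointD[OF AB] by (simp add: hdist_eq adjoint_minus[OF AB])
  then show thesis by (rule that)
qed

section \<open>Adjoints, traces and Hilbert-Schmidt norms of real multiples\<close>

lemma hadjoint_eqI: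
  assumes "z \<in> carrier H" "\<And>x. x \<in> carrier H \<Longrightarrow> ip (A x) y = ip x z"
  shows "hadjoint H A y = z"
  unfolding hadjoint_def
proof (rule the_equality)
  show "z \<in> carrier H \<and> (\<forall>x\<in>carrier H. ip (A x) y = ip x z)"
    using assms by blast
  show "w = z" if "w \<in> carrier H \<and> (\<forall>x\<in>carrier H. ip (A x) y = ip x w)" for w
    by (rule eqI_ip) (use that assms in auto)
qed

text \<open>The hypothesis on A' is confined to the carrier because it will be used for
  localizations, which are \<open>undefined\<close> elsewhere. The factor is real and hence its own
  conjugate.\<close>

lemma hadjoint_scaled:
  assumes AB: "mutually_adjoint A B" and A': "\<And>x. x \<in> carrier H \<Longrightarrow> A' x = complex_of_real r \<odot> A x"
    and y: "y \<in> carrier H"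
  shows "hadjoint H A' y = complex_of_real r \<odot> B y"
  by (rule hadjoint_eqI)
    (use y in \<open>simp_all add: A' mutually_adjointD[OF AB] ip_smult_left ip_smult_right\<close>)

lemma hadjoint_eq: "mutually_adjoint A B \<Longrightarrow> y \<in> carrier H \<Longrightarrow> hadjoint H A y = B y"
  by (rule hadjoint_eqI) (auto simp: mutually_adjointD)

lemma htrace_cong:
  assumes "\<And>x. x \<in> carrier H \<Longrightarrow> A x = B x"
  shows "htrace H A = htrace H B" "htrace_finite H A \<longleftrightarrow> htrace_finite H B"
proof -
  have "A e = B e" if "e \<in> onb H" for e
    using that onb_subset assms by blast
  then show "htrace H A = htrace H B" "htrace_finite H A \<longleftrightarrow> htrace_finite H B"
    unfolding htrace_def htrace_finite_def
    by (auto intro!: infsum_cong summable_on_cong)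
qed

lemma htrace_smult:
  assumes "\<And>x. x \<in> carrier H \<Longrightarrow> A x \<in> carrier H"
  shows "htrace H (\<lambda>x. c \<odot> A x) = c * htrace H A"
proof -
  have "htrace H (\<lambda>x. c \<odot> A x) = (\<Sum>\<^sub>\<infinity>e\<in>onb H. c * ip (A e) e)"
    unfolding htrace_def using assms onb_subset by (intro infsum_cong ip_smult_left) blast+
  then show ?thesis
    by (simp add: infsum_cmult_right' htrace_def)
qed

lemma htrace_finite_smult:
  assumes "\<And>x. x \<in> carrier H \<Longrightarrow> A x \<in> carrier H" "htrace_finite H A"
  shows "htrace_finite H (\<lambda>x. c \<odot> A x)"
proof -
  have "(\<lambda>e. ip (c \<odot> A e) e) summable_on onb H \<longleftrightarrow> (\<lambda>e. c * ip (A e) e) summable_on onb H"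
    using assms(1) onb_subset by (intro summable_on_cong ip_smult_left) blast+
  then show ?thesis
    using assms(2) by (simp add: htrace_finite_def summable_on_cmult_right)
qed

context
  fixes A B A' :: "'h \<Rightarrow> 'h" and r :: real
  assumes AB: "mutually_adjoint A B" and A': "\<And>x. x \<in> carrier H \<Longrightarrow> A' x = complex_of_real r \<odot> A x"
begin

private lemma abs_sq_scaled:
  assumes "x \<in> carrier H"
  shows "abs_sq H A' x = complex_of_real (r\<^sup>2) \<odot> abs_sq H A x"
  using assms mutually_adjointD[OF AB]
  by (simp add: abs_sq_def A' hadjoint_scaled[OF AB A'] hadjoint_eq[OF AB] smult_smult power2_eq_square
      adjoint_smult[OF mutually_adjoint_sym[OF AB]])

private lemma abs_sq_closed: "x \<in> carrier H \<Longrightarrow> abs_sq H A x \<in> carrier H"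
  by (simp add: abs_sq_def hadjoint_eq[OF AB] mutually_adjointD[OF AB])

lemma htrace_abs_sq_scaled: "htrace H (abs_sq H A') = complex_of_real (r\<^sup>2) * htrace H (abs_sq H A)"
  using htrace_cong(1)[OF abs_sq_scaled] htrace_smult[OF abs_sq_closed] by simp

lemma htrace_finite_abs_sq_scaled: "htrace_finite H (abs_sq H A) \<Longrightarrow> htrace_finite H (abs_sq H A')"
  using htrace_cong(2)[OF abs_sq_scaled] htrace_finite_smult[OF abs_sq_closed] by simp

lemma hs_norm_scaled: "hs_norm H A' = \<bar>r\<bar> * hs_norm H A"
  by (simp add: hs_norm_def htrace_abs_sq_scaled real_sqrt_mult del: of_real_power)

text \<open>\<open>hs_inner H D A\<close> is the trace of A* D, so an adjoint is required of the
  second operator only. D can therefore be a translate, whose adjoint is never computed.\<close>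

lemma hs_inner_scaled:
  assumes D: "\<And>x. x \<in> carrier H \<Longrightarrow> D x \<in> carrier H"
    and D': "\<And>x. x \<in> carrier H \<Longrightarrow> D' x = complex_of_real s \<odot> D x"
  shows "hs_inner H D' A' = complex_of_real (s * r) * hs_inner H D A"
proof -
  have "hadjoint H A' (D' x) = complex_of_real (s * r) \<odot> hadjoint H A (D x)" if "x \<in> carrier H" for x
    using that D mutually_adjointD[OF AB]
    by (simp add: D' hadjoint_scaled[OF AB A'] hadjoint_eq[OF AB] smult_smult mult.commute
        adjoint_smult[OF mutually_adjoint_sym[OF AB]])
  then have "hs_inner H D' A' = htrace H (\<lambda>x. complex_of_real (s * r) \<odot> hadjoint H A (D x))"
    unfolding hs_inner_def by (rule htrace_cong(1))
  then show ?thesis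
    using D mutually_adjointD[OF AB]
    by (simp add: hs_inner_def htrace_smult hadjoint_eq[OF AB] del: of_real_mult)
qed

end

section \<open>Unitaries and weak continuity\<close>

lemma unitary_mapD:
  assumes "unitary_map H H V"
  shows "x \<in> carrier H \<Longrightarrow> V x \<in> carrier H" "inj_on V (carrier H)"
    "x \<in> carrier H \<Longrightarrow> V (a \<odot> x) = a \<odot> V x"
    "x \<in> carrier H \<Longrightarrow> y \<in> carrier H \<Longrightarrow> hdist H (V x) (V y) = hdist H x y"
    "x \<in> carrier H \<Longrightarrow> nrm (V x) = nrm x"
proof -
  have bij: "bij_betw V (carrier H) (carrier H)" and add: "\<And>x y. x \<in> carrier H \<Longrightarrow> y \<in> carrier H \<Longrightarrow> V (x \<oplus> y) = V x \<oplus> V y"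
    and sm: "\<And>a x. x \<in> carrier H \<Longrightarrow> V (a \<odot> x) = a \<odot> V x"
    and ip: "\<And>x. x \<in> carrier H \<Longrightarrow> ip (V x) (V x) = ip x x"
    using assms by (auto simp: unitary_map_def)
  show car: "V x \<in> carrier H" if "x \<in> carrier H" for x
    using bij that by (auto simp: bij_betw_def)
  show "inj_on V (carrier H)"
    using bij by (simp add: bij_betw_def)
  show "V (a \<odot> x) = a \<odot> V x" if "x \<in> carrier H" for a x
    using sm that by simp
  show nrm: "nrm (V x) = nrm x" if "x \<in> carrier H" for x
    using ip[OF that] by (simp add: hnorm_def)
  show "hdist H (V x) (V y) = hdist H x y" if "x \<in> carrier H" "y \<in> carrier H" for x y
  proof -
    have "V x \<ominus> V y = V (x \<ominus> y)"
      using that car by (simp add: minus_eq_smult add sm)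
    then show ?thesis
      using that car nrm[of "x \<ominus> y"] by (simp add: hdist_eq)
  qed
qed

text \<open>Representations are tested on sections, but the representation of the isotropy group
  supplies continuity for fixed vectors. Unitaries are isometric, so replacing f y by f x and g y by
  g x costs an error that does not depend on the unitary.\<close>

lemma continuous_ip_unitary:
  assumes f: "continuous_map X (htopology H) f" and g: "continuous_map X (htopology H) g"
    and V: "\<And>x. x \<in> topspace X \<Longrightarrow> unitary_map H H (V x)"
    and weak: "\<And>h k. h \<in> carrier H \<Longrightarrow> k \<in> carrier H \<Longrightarrow> continuous_map X euclidean (\<lambda>x. ip (V x h) k)"
  shows "continuous_map X euclidean (\<lambda>x. ip (V x (f x)) (g x))"
  unfolding continuous_map_atin limitin_canonical_iff
proof
  fix x assume x: "x \<in> topspace X"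
  have car: "\<And>x. x \<in> topspace X \<Longrightarrow> f x \<in> carrier H \<and> g x \<in> carrier H"
    using f g by (auto simp: continuous_iff)
  \<comment> \<open>The summands bound the replacement of f y by f x, then of g y by g x, then of V
    y by V x.\<close>
  let ?b = "\<lambda>y. hdist H (f y) (f x) * nrm (g y) + nrm (f x) * hdist H (g y) (g x)
    + norm (ip (V y (f x)) (g x) - ip (V x (f x)) (g x))"
  show "((\<lambda>y. ip (V y (f y)) (g y)) \<longlongrightarrow> ip (V x (f x)) (g x)) (atin X x)"
  proof (rule LIM_zero_cancel, rule tendsto_0_le[where K = 1])
    have "((\<lambda>y. hdist H (f y) (f x)) \<longlongrightarrow> 0) (atin X x)" "((\<lambda>y. hdist H (g y) (g x)) \<longlongrightarrow> 0) (atin X x)"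
      using f g x by (auto simp: continuous_iff)
    moreover have "((\<lambda>y. nrm (g y)) \<longlongrightarrow> nrm (g x)) (atin X x)"
      using continuous_nrm[OF g] x by (simp add: continuous_map_atin)
    moreover have "((\<lambda>y. ip (V y (f x)) (g x)) \<longlongrightarrow> ip (V x (f x)) (g x)) (atin X x)"
      using weak[of "f x" "g x"] car[OF x] x by (simp add: continuous_map_atin)
    ultimately have "(?b \<longlongrightarrow> 0 * nrm (g x) + nrm (f x) * 0
        + norm (ip (V x (f x)) (g x) - ip (V x (f x)) (g x))) (atin X x)"
      by (intro tendsto_intros)
    then show "(?b \<longlongrightarrow> 0) (atin X x)" by simp
    have "norm (ip (V y (f y)) (g y) - ip (V x (f x)) (g x)) \<le> ?b y" if y: "y \<in> topspace X" for y
    proof -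
      note V' = unitary_mapD[OF V[OF y]]
      have c: "f x \<in> carrier H" "f y \<in> carrier H" "g x \<in> carrier H" "g y \<in> carrier H"
        using car x y by auto
      have a: "norm (ip (V y (f y)) (g y) - ip (V y (f x)) (g y)) \<le> hdist H (f y) (f x) * nrm (g y)"
        using ip_diff_le[of "V y (f y)" "V y (f x)" "g y"] c V' by simp
      have b: "norm (ip (V y (f x)) (g y) - ip (V y (f x)) (g x)) \<le> nrm (f x) * hdist H (g y) (g x)"
      proof -
        \<comment> \<open>\<open>ip_diff_le\<close> treats differences in the first argument, so the
          arguments are exchanged by conjugation.\<close>
        have "ip (V y (f x)) (g y) - ip (V y (f x)) (g x) = cnj (ip (g y) (V y (f x)) - ip (g x) (V y (f x)))"
          using c V'(1) ip_commute[of "g y" "V y (f x)"] ip_commute[of "g x" "V y (f x)"] by simp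
        then show ?thesis
          using ip_diff_le[of "g y" "g x" "V y (f x)"] c V' by (simp add: mult.commute del: complex_cnj_diff)
      qed
      show ?thesis
        by (rule norm_diff_triangle_le[OF norm_diff_triangle_le[OF a b] order_refl])
    qed
    then show "\<forall>\<^sub>F y in atin X x. norm (ip (V y (f y)) (g y) - ip (V x (f x)) (g x)) \<le> norm (?b y) * 1"
      unfolding eventually_atin using x by (force intro!: exI[of _ "topspace X"])
  qed
qed

end

section \<open>Functions vanishing at infinity\<close>

text \<open>Superlevel sets of a continuous function are closed, and closed subsets of compact sets
  are compact; any compact superset will do.\<close>

lemma c0_functionI:
  assumes f: "continuous_map X euclidean f"
    and K: "\<And>\<epsilon>. \<epsilon> > 0 \<Longrightarrow> \<exists>K. compactin X K \<and> {x \<in> topspace X. \<epsilon> \<le> norm (f x)} \<subseteq> K"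
  shows "c0_function X f"
  unfolding c0_function_def
proof (intro conjI allI impI f)
  fix \<epsilon> :: real assume "\<epsilon> > 0"
  then obtain K where K: "compactin X K" "{x \<in> topspace X. \<epsilon> \<le> norm (f x)} \<subseteq> K"
    using assms(2) by blast
  have "closedin X {x \<in> topspace X. norm (f x) \<in> {\<epsilon>..}}"
    by (rule closedin_continuous_map_preimage[where Y = euclideanreal]) (use f continuous_map_norm in auto)
  then show "compactin X {x \<in> topspace X. \<epsilon> \<le> norm (f x)}"
    using closed_compactin[OF K(1)] K(2) by simp
qed

lemma c0_function_dominated:
  fixes g :: "'a \<Rightarrow> 'b::real_normed_vector"
  assumes f: "c0_function X f" and g: "continuous_map X euclidean g"
    and le: "\<And>x. x \<in> topspace X \<Longrightarrow> norm (g x) \<le> C * norm (f x)"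
  shows "c0_function X g"
proof (rule c0_functionI[OF g])
  fix \<epsilon> :: real assume e: "\<epsilon> > 0"
  \<comment> \<open>C may be zero or negative, and \<epsilon> is about to be divided by the
    constant.\<close>
  define D where "D = \<bar>C\<bar> + 1"
  have D: "D > 0" "C \<le> D" by (auto simp: D_def)
  have "{x \<in> topspace X. \<epsilon> \<le> norm (g x)} \<subseteq> {x \<in> topspace X. \<epsilon> / D \<le> norm (f x)}"
  proof clarify
    fix x assume x: "x \<in> topspace X" and "\<epsilon> \<le> norm (g x)"
    then have "\<epsilon> \<le> C * norm (f x)"
      using le by force
    also have "\<dots> \<le> D * norm (f x)"
      using D by (intro mult_right_mono) auto
    finally show "\<epsilon> / D \<le> norm (f x)"
      using D by (simp add: field_simps)
  qed
  moreover have "compactin X {x \<in> topspace X. \<epsilon> / D \<le> norm (f x)}"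
    using f e D unfolding c0_function_def by simp
  ultimately show "\<exists>K. compactin X K \<and> {x \<in> topspace X. \<epsilon> \<le> norm (g x)} \<subseteq> K"
    by blast
qed

lemma continuous_map_of_real:
  "continuous_map X euclideanreal f \<Longrightarrow> continuous_map X euclidean (\<lambda>x. complex_of_real (f x))"
  unfolding continuous_map_atin limitin_canonical_iff by (auto intro!: tendsto_of_real)

lemma c0_function_of_real: "c0_function X f \<Longrightarrow> c0_function X (\<lambda>x. complex_of_real (f x))"
  by (rule c0_function_dominated[where f = f and C = 1])
    (auto simp: c0_function_def continuous_map_of_real)

text \<open>With K = \<open>{}\<close> only the range [0, 1] and the decay remain; this is the form
  in which the operators use it. A nonempty K is for the places where \<phi> must equal 1.\<close>

definition cutoff_on :: "'a topology \<Rightarrow> 'a set \<Rightarrow> ('a \<Rightarrow> real) \<Rightarrow> bool" where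
  "cutoff_on X K \<phi> \<longleftrightarrow>
    c0_function X \<phi> \<and> (\<forall>x\<in>topspace X. 0 \<le> \<phi> x \<and> \<phi> x \<le> 1) \<and> (\<forall>x\<in>K. \<phi> x = 1)"

lemma cutoff_on_mono: "cutoff_on X K \<phi> \<Longrightarrow> L \<subseteq> K \<Longrightarrow> cutoff_on X L \<phi>"
  by (auto simp: cutoff_on_def)

lemma ex_cutoff_on:
  assumes lc: "locally_compact_space X" and haus: "Hausdorff_space X" and K: "compactin X K"
  shows "\<exists>\<phi>. cutoff_on X K \<phi>"
proof -
  obtain U L where UL: "openin X U" "compactin X L" "K \<subseteq> U" "U \<subseteq> L"
    using lc haus K locally_compact_space_compact_closed_compact[of X] by metis
  have "completely_regular_space X"
    using lc haus locally_compact_Hausdorff_or_regular locally_compact_regular_imp_completely_regular_space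
    by blast
  moreover have "closedin X (topspace X - U)" "disjnt (topspace X - U) K"
    using UL by (auto simp: disjnt_def)
  \<comment> \<open>Urysohn's lemma takes the lower endpoint -1 on K and the upper endpoint 0 off U.
    The cutoff is \<open>- \<phi>\<close>, whose superlevel sets lie in L.\<close>
  ultimately obtain \<phi> :: "'a \<Rightarrow> real" where \<phi>: "continuous_map X (subtopology euclidean {-1..0}) \<phi>"
      "\<phi> ` K \<subseteq> {-1}" "\<phi> ` (topspace X - U) \<subseteq> {0}"
    using Urysohn_completely_regular_closed_compact[of "-1" 0 X "topspace X - U" K] K by auto
  have cont: "continuous_map X euclideanreal \<phi>" and rng: "\<And>x. x \<in> topspace X \<Longrightarrow> \<phi> x \<in> {-1..0}"
    using \<phi>(1) by (auto simp: continuous_map_in_subtopology)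
  have "c0_function X (\<lambda>x. - \<phi> x)"
  proof (rule c0_functionI)
    show "continuous_map X euclideanreal (\<lambda>x. - \<phi> x)"
      by (intro continuous_map_minus cont)
    show "\<exists>K. compactin X K \<and> {x \<in> topspace X. \<epsilon> \<le> norm (- \<phi> x)} \<subseteq> K" if "\<epsilon> > 0" for \<epsilon>
      using that UL \<phi>(3) by (intro exI[of _ L]) force
  qed
  moreover have "\<forall>x\<in>topspace X. 0 \<le> - \<phi> x \<and> - \<phi> x \<le> 1" "\<forall>x\<in>K. - \<phi> x = 1"
    using rng \<phi>(2) by fastforce+
  ultimately show ?thesis
    unfolding cutoff_on_def by blast
qed

text \<open>The members of a countable base that lie inside compact sets cover the space. A compact
  set lies in the union of finitely many of them, and there are only countably many finite families,
  so one chosen cutoff for each family is enough. These cutoffs enter the generators of the module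
  of C_0 sections.\<close>

lemma ex_countable_cutoffs:
  assumes lc: "locally_compact_space X" and haus: "Hausdorff_space X" and sc: "second_countable X"
  obtains \<Phi> where "countable \<Phi>" "\<And>\<phi>. \<phi> \<in> \<Phi> \<Longrightarrow> cutoff_on X {} \<phi>"
    "\<And>K. compactin X K \<Longrightarrow> \<exists>\<phi>\<in>\<Phi>. cutoff_on X K \<phi>"
proof -
  obtain \<B> where \<B>: "countable \<B>" "\<And>V. V \<in> \<B> \<Longrightarrow> openin X V"
      "\<And>U x. openin X U \<Longrightarrow> x \<in> U \<Longrightarrow> \<exists>V\<in>\<B>. x \<in> V \<and> V \<subseteq> U"
    using sc unfolding second_countable_def by metis
  define \<C> where "\<C> = {V \<in> \<B>. \<exists>L. compactin X L \<and> V \<subseteq> L}"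
  have C_open: "\<And>V. V \<in> \<C> \<Longrightarrow> openin X V"
    using \<B>(2) by (simp add: \<C>_def)
  have ex: "\<exists>\<phi>. cutoff_on X (\<Union>F) \<phi>" if F: "finite F" "F \<subseteq> \<C>" for F
  proof -
    have "\<forall>V\<in>F. \<exists>L. compactin X L \<and> V \<subseteq> L"
      using F(2) by (auto simp: \<C>_def)
    from bchoice[OF this] obtain L where "\<And>V. V \<in> F \<Longrightarrow> compactin X (L V) \<and> V \<subseteq> L V"
      by blast
    then have "compactin X (\<Union>(L ` F))" "\<Union>F \<subseteq> \<Union>(L ` F)"
      using F(1) by (auto intro!: compactin_Union)
    then show ?thesis
      using ex_cutoff_on[OF lc haus] cutoff_on_mono by metis
  qed
  define \<phi> where "\<phi> F = (SOME \<psi>. cutoff_on X (\<Union>F) \<psi>)" for F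
  have \<phi>: "cutoff_on X (\<Union>F) (\<phi> F)" if "finite F" "F \<subseteq> \<C>" for F
    unfolding \<phi>_def by (rule someI_ex[OF ex[OF that]])
  show thesis
  proof
    show "countable (\<phi> ` {F. finite F \<and> F \<subseteq> \<C>})"
      using \<B>(1) unfolding \<C>_def by (intro countable_image countable_Collect_finite_subset) auto
    show "cutoff_on X {} \<psi>" if "\<psi> \<in> \<phi> ` {F. finite F \<and> F \<subseteq> \<C>}" for \<psi>
      using that \<phi> by (auto intro: cutoff_on_mono)
    show "\<exists>\<psi>\<in>\<phi> ` {F. finite F \<and> F \<subseteq> \<C>}. cutoff_on X K \<psi>" if K: "compactin X K" for K
    proof -
      have "K \<subseteq> \<Union>\<C>"
      proof
        fix x assume "x \<in> K"
        then have "x \<in> topspace X"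
          using compactin_subset_topspace[OF K] by blast
        then obtain U L where "openin X U" "compactin X L" "x \<in> U" "U \<subseteq> L"
          using lc unfolding locally_compact_space_def by blast
        with \<B>(3)[of U x] show "x \<in> \<Union>\<C>"
          unfolding \<C>_def by blast
      qed
      then obtain F where F: "finite F" "F \<subseteq> \<C>" "K \<subseteq> \<Union>F"
        using compactinD[OF K, of \<C>] C_open by blast
      then have "cutoff_on X K (\<phi> F)"
        by (intro cutoff_on_mono[OF \<phi>])
      with F show ?thesis by blast
    qed
  qed
qed

section \<open>Constant Hilbert bundles\<close>

definition const_bundle :: "'a topology \<Rightarrow> 'h hilb \<Rightarrow> ('a, 'h) hilbert_bundle" where
  "const_bundle X H =
    \<lparr>fibre = \<lambda>_. H, cts_sections = {\<xi> \<in> topspace X \<rightarrow>\<^sub>E carrier H. continuous_map X (htopology H) \<xi>}\<rparr>"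

lemma fibre_const_bundle [simp]: "fibre (const_bundle X H) v = H"
  by (simp add: const_bundle_def)

locale hilbert_over = hilbert H for H :: "'h hilb" (structure) +
  fixes X :: "'a topology"
  assumes lc: "locally_compact_space X" and haus: "Hausdorff_space X"
begin

abbreviation \<E> where "\<E> \<equiv> const_bundle X H"

lemma mem_cts_sections:
  "\<xi> \<in> cts_sections \<E> \<longleftrightarrow> \<xi> \<in> extensional (topspace X) \<and> continuous_map X (htopology H) \<xi>"
  by (auto simp: const_bundle_def PiE_def continuous_iff)

lemma mem_c0_sections:
  "\<xi> \<in> c0_sections X \<E> \<longleftrightarrow> \<xi> \<in> extensional (topspace X) \<and> continuous_map X (htopology H) \<xi> \<and>
    c0_function X (\<lambda>v. nrm (\<xi> v))"
  by (auto simp: c0_sections_def mem_cts_sections)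

lemma continuous_restrict:
  "continuous_map X (htopology H) f \<Longrightarrow> continuous_map X (htopology H) (restrict f (topspace X))"
  by (erule continuous_map_eq) simp

lemma const_hilbert_bundle:
  assumes "separable_space (htopology H)"
  shows "continuous_hilbert_bundle X \<E>"
  unfolding continuous_hilbert_bundle_def fibre_const_bundle
proof (intro conjI ballI allI impI)
  show "hilbert_space H" by (rule hilbert)
  show "separable_space (htopology H)" by (rule assms)
  show "cts_sections \<E> \<subseteq> (\<Pi>\<^sub>E v\<in>topspace X. carrier H)"
    by (auto simp: const_bundle_def)
  show "sec_zero X \<E> \<in> cts_sections \<E>"
    by (auto simp: mem_cts_sections sec_zero_def intro!: continuous_restrict)
  show "sec_add X \<E> \<xi> \<eta> \<in> cts_sections \<E>" if "\<xi> \<in> cts_sections \<E>" "\<eta> \<in> cts_sections \<E>" for \<xi> \<eta>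
    using that by (auto simp: mem_cts_sections sec_add_def intro!: continuous_restrict continuous_add)
  show "sec_scale X \<E> (\<lambda>_. c) \<xi> \<in> cts_sections \<E>" if "\<xi> \<in> cts_sections \<E>" for c \<xi>
    using that by (auto simp: mem_cts_sections sec_scale_def intro!: continuous_restrict continuous_smult)
  show "continuous_map X euclideanreal (\<lambda>v. nrm (\<xi> v))" if "\<xi> \<in> cts_sections \<E>" for \<xi>
    using that by (simp add: mem_cts_sections continuous_nrm)
  show "mtopology closure_of ((\<lambda>\<xi>. \<xi> v) ` cts_sections \<E>) = carrier H" if v: "v \<in> topspace X" for v
  proof -
    \<comment> \<open>Constant sections reach every vector, so the values at v fill the fibre and
      are not merely dense.\<close>
    have "h \<in> (\<lambda>\<xi>. \<xi> v) ` cts_sections \<E>" if "h \<in> carrier H" for h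
      by (rule image_eqI[of _ _ "\<lambda>v\<in>topspace X. h"])
        (use that v in \<open>auto simp: mem_cts_sections intro!: continuous_restrict\<close>)
    moreover have "(\<lambda>\<xi>. \<xi> v) ` cts_sections \<E> \<subseteq> carrier H"
      using v by (auto simp: mem_cts_sections continuous_iff)
    ultimately have "(\<lambda>\<xi>. \<xi> v) ` cts_sections \<E> = carrier H" by blast
    then show ?thesis
      using closure_of_topspace[of mtopology] by simp
  qed
  fix \<xi> assume \<xi>: "\<xi> \<in> (\<Pi>\<^sub>E v\<in>topspace X. carrier H)"
    and approx: "\<forall>v\<in>topspace X. \<forall>\<epsilon>>0. \<exists>\<eta>\<in>cts_sections \<E>. \<exists>U. openin X U \<and> v \<in> U \<and>
      (\<forall>w\<in>U. hdist H (\<xi> w) (\<eta> w) < \<epsilon>)"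
  have car: "\<xi> v \<in> carrier H" if "v \<in> topspace X" for v
    using that \<xi> by (auto simp: PiE_def)
  \<comment> \<open>A locally uniform limit of continuous maps is continuous, by splitting the
    distance into three parts below \<epsilon> / 3.\<close>
  have "continuous_map X mtopology \<xi>"
    unfolding continuous_map_to_metric
  proof (intro ballI allI impI)
    fix v and \<epsilon> :: real assume v: "v \<in> topspace X" and e: "\<epsilon> > 0"
    then obtain \<eta> U where \<eta>: "\<eta> \<in> cts_sections \<E>" and U: "openin X U" "v \<in> U"
      and d: "\<And>w. w \<in> U \<Longrightarrow> hdist H (\<xi> w) (\<eta> w) < \<epsilon> / 3"
      using approx[rule_format, of v "\<epsilon> / 3"] by auto
    from \<eta> have "continuous_map X mtopology \<eta>"
      by (simp add: mem_cts_sections)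
    then obtain V where V: "openin X V" "v \<in> V" "\<And>w. w \<in> V \<Longrightarrow> \<eta> w \<in> mball (\<eta> v) (\<epsilon> / 3)"
      using v e unfolding continuous_map_to_metric by (metis zero_less_divide_iff zero_less_numeral)
    show "\<exists>U. openin X U \<and> v \<in> U \<and> (\<forall>w\<in>U. \<xi> w \<in> mball (\<xi> v) \<epsilon>)"
    proof (intro exI[of _ "U \<inter> V"] conjI ballI)
      show "openin X (U \<inter> V)" "v \<in> U \<inter> V" using U V by auto
      fix w assume w: "w \<in> U \<inter> V"
      then have wX: "w \<in> topspace X" using U openin_subset by blast
      have *: "\<eta> v \<in> carrier H" "\<eta> w \<in> carrier H" "hdist H (\<eta> v) (\<eta> w) < \<epsilon> / 3"
        using V(3)[of w] w by auto
      have "hdist H (\<xi> v) (\<xi> w) \<le> hdist H (\<xi> v) (\<eta> v) + (hdist H (\<eta> v) (\<eta> w) + hdist H (\<eta> w) (\<xi> w))"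
        using triangle[of "\<xi> v" "\<eta> v" "\<xi> w"] triangle[of "\<eta> v" "\<eta> w" "\<xi> w"] * car v wX by force
      also have "\<dots> < \<epsilon>"
        using d[of v] d[of w] * w U commute[of "\<eta> w" "\<xi> w"] by auto
      finally show "\<xi> w \<in> mball (\<xi> v) \<epsilon>"
        using car v wX by simp
    qed
  qed
  then show "\<xi> \<in> cts_sections \<E>"
    using \<xi> by (simp add: mem_cts_sections PiE_def)
qed

section \<open>Elementary C_0 sections and diagonal operators\<close>

lemma c0_smult_const:
  assumes "c0_function X a" "h \<in> carrier H"
  shows "(\<lambda>v\<in>topspace X. a v \<odot> h) \<in> c0_sections X \<E>"
  unfolding mem_c0_sections
proof (intro conjI)
  show "continuous_map X mtopology (\<lambda>v\<in>topspace X. a v \<odot> h)"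
    using assms by (intro continuous_restrict continuous_smult) (auto simp: c0_function_def)
  then have "continuous_map X euclideanreal (\<lambda>v. nrm ((\<lambda>v\<in>topspace X. a v \<odot> h) v))"
    by (rule continuous_nrm)
  then show "c0_function X (\<lambda>v. nrm ((\<lambda>v\<in>topspace X. a v \<odot> h) v))"
    by (rule c0_function_dominated[OF assms(1), where C = "nrm h"]) (use assms(2) in \<open>simp add: abs_mult mult.commute\<close>)
qed auto

text \<open>\<open>localization\<close> picks a section through h by \<open>SOME\<close>; this is
  why the choice succeeds.\<close>

lemma ex_c0_section:
  assumes "v \<in> topspace X" "h \<in> carrier H"
  shows "\<exists>\<xi>. \<xi> \<in> c0_sections X \<E> \<and> \<xi> v = h"
proof -
  obtain \<phi> where "cutoff_on X {v} \<phi>"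
    using ex_cutoff_on[OF lc haus, of "{v}"] assms(1) by auto
  then show ?thesis
    using c0_smult_const[of "\<lambda>v. complex_of_real (\<phi> v)" h] assms
    by (intro exI[of _ "\<lambda>w\<in>topspace X. complex_of_real (\<phi> w) \<odot> h"])
      (auto simp: cutoff_on_def c0_function_of_real)
qed

definition diagonal_operator :: "('a \<Rightarrow> real) \<Rightarrow> ('h \<Rightarrow> 'h) \<Rightarrow> ('a, 'h) section_operator" where
  "diagonal_operator \<phi> A \<xi> = (\<lambda>v\<in>topspace X. complex_of_real (\<phi> v) \<odot> A (\<xi> v))"

text \<open>Continuity comes from the Lipschitz bound for A. The decay is that of \<xi>, since A is
  bounded and \<phi> is at most 1.\<close>

lemma diagonal_operator_c0:
  assumes AB: "mutually_adjoint A B" and \<phi>: "cutoff_on X {} \<phi>" and \<xi>: "\<xi> \<in> c0_sections X \<E>"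
  shows "diagonal_operator \<phi> A \<xi> \<in> c0_sections X \<E>"
  unfolding mem_c0_sections
proof (intro conjI)
  have cont: "continuous_map X mtopology \<xi>" and car: "\<And>v. v \<in> topspace X \<Longrightarrow> \<xi> v \<in> carrier H"
    using \<xi> by (auto simp: mem_c0_sections continuous_iff)
  obtain C where "\<And>x y. x \<in> carrier H \<Longrightarrow> y \<in> carrier H \<Longrightarrow> hdist H (A x) (A y) \<le> C * hdist H x y"
    using adjoint_lipschitz[OF AB] by blast
  then have "continuous_map X mtopology (\<lambda>v. A (\<xi> v))"
    by (intro continuous_lipschitz[OF cont mutually_adjointD(1)[OF AB]])
  then show "continuous_map X mtopology (diagonal_operator \<phi> A \<xi>)"
    unfolding diagonal_operator_def using \<phi>
    by (intro continuous_restrict continuous_smult continuous_map_of_real)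
      (auto simp: cutoff_on_def c0_function_def)
  then have cn: "continuous_map X euclideanreal (\<lambda>v. nrm (diagonal_operator \<phi> A \<xi> v))"
    by (rule continuous_nrm)
  obtain C where C: "\<And>x. x \<in> carrier H \<Longrightarrow> nrm (A x) \<le> C * nrm x"
    using adjoint_bounded[OF AB] by blast
  have "norm (nrm (diagonal_operator \<phi> A \<xi> v)) \<le> C * norm (nrm (\<xi> v))"
    if v: "v \<in> topspace X" for v
  proof -
    have "\<bar>\<phi> v\<bar> * nrm (A (\<xi> v)) \<le> 1 * nrm (A (\<xi> v))"
      using \<phi> v car mutually_adjointD(1)[OF AB] by (intro mult_right_mono) (auto simp: cutoff_on_def)
    then show ?thesis
      using C[OF car[OF v]] v car mutually_adjointD(1)[OF AB] by (simp add: diagonal_operator_def)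
  qed
  moreover have "c0_function X (\<lambda>v. nrm (\<xi> v))"
    using \<xi> by (simp add: mem_c0_sections)
  ultimately show "c0_function X (\<lambda>v. nrm (diagonal_operator \<phi> A \<xi> v))"
    using c0_function_dominated[OF _ cn] by blast
qed (simp add: diagonal_operator_def)

text \<open>As \<phi> is real, the diagonal operator of \<phi> and B is an adjoint.\<close>

lemma adjointable_diagonal_operator:
  assumes AB: "mutually_adjoint A B" and \<phi>: "cutoff_on X {} \<phi>"
  shows "adjointable X \<E> (diagonal_operator \<phi> A)"
  unfolding adjointable_def
proof (intro conjI exI ballI)
  show "diagonal_operator \<phi> A ` c0_sections X \<E> \<subseteq> c0_sections X \<E>"
    using diagonal_operator_c0[OF AB \<phi>] by blast
  show "diagonal_operator \<phi> B ` c0_sections X \<E> \<subseteq> c0_sections X \<E>"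
    using diagonal_operator_c0[OF mutually_adjoint_sym[OF AB] \<phi>] by blast
  fix \<xi> \<eta> v assume "\<xi> \<in> c0_sections X \<E>" "\<eta> \<in> c0_sections X \<E>" and v: "v \<in> topspace X"
  then have "\<xi> v \<in> carrier H" "\<eta> v \<in> carrier H"
    by (auto simp: mem_c0_sections continuous_iff)
  then show "hinner (fibre \<E> v) (diagonal_operator \<phi> A \<xi> v) (\<eta> v)
      = hinner (fibre \<E> v) (\<xi> v) (diagonal_operator \<phi> B \<eta> v)"
    using v by (simp add: diagonal_operator_def ip_smult_left ip_smult_right mutually_adjointD[OF AB])
qed

text \<open>Whichever section \<open>SOME\<close> selects, the diagonal operator at v reads only its
  value there, which is h.\<close>

lemma localization_diagonal_operator:
  assumes v: "v \<in> topspace X" and h: "h \<in> carrier H"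
  shows "localization X \<E> (diagonal_operator \<phi> A) v h = complex_of_real (\<phi> v) \<odot> A h"
  using someI_ex[OF ex_c0_section[OF assms]] v h
  by (simp add: localization_def diagonal_operator_def)

text \<open>The trace at v is \<phi>(v)^2 times a constant, and \<phi>^2 \<le> \<phi> on [0, 1], so
  it inherits the decay of \<phi>.\<close>

lemma hilbert_schmidt_diagonal_operator:
  assumes AB: "mutually_adjoint A B" and \<phi>: "cutoff_on X {} \<phi>" and fin: "htrace_finite H (abs_sq H A)"
  shows "hilbert_schmidt X \<E> (diagonal_operator \<phi> A)"
  unfolding hilbert_schmidt_def
proof (intro conjI ballI)
  show "adjointable X \<E> (diagonal_operator \<phi> A)"
    by (rule adjointable_diagonal_operator[OF AB \<phi>])
  show "htrace_finite (fibre \<E> v) (abs_sq (fibre \<E> v) (localization X \<E> (diagonal_operator \<phi> A) v))"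
    if "v \<in> topspace X" for v
    using htrace_finite_abs_sq_scaled[OF AB localization_diagonal_operator[OF that, of _ \<phi> A] fin] by simp
  have tr: "htrace H (abs_sq H (localization X \<E> (diagonal_operator \<phi> A) v))
      = complex_of_real ((\<phi> v)\<^sup>2) * htrace H (abs_sq H A)" if "v \<in> topspace X" for v
    by (rule htrace_abs_sq_scaled[OF AB localization_diagonal_operator[OF that, of _ \<phi> A]])
  have cont: "continuous_map X euclideanreal \<phi>" and le: "\<And>v. v \<in> topspace X \<Longrightarrow> 0 \<le> \<phi> v \<and> \<phi> v \<le> 1"
    using \<phi> by (auto simp: cutoff_on_def c0_function_def)
  have "continuous_map X euclidean (\<lambda>v. complex_of_real ((\<phi> v)\<^sup>2) * htrace H (abs_sq H A))"
    using cont unfolding continuous_map_atin limitin_canonical_iff by (auto intro!: tendsto_intros)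
  then have "continuous_map X euclidean
      (\<lambda>v. htrace (fibre \<E> v) (abs_sq (fibre \<E> v) (localization X \<E> (diagonal_operator \<phi> A) v)))"
    by (rule continuous_map_eq) (simp add: tr)
  then show "c0_function X
      (\<lambda>v. htrace (fibre \<E> v) (abs_sq (fibre \<E> v) (localization X \<E> (diagonal_operator \<phi> A) v)))"
  proof (rule c0_function_dominated[where f = \<phi> and C = "norm (htrace H (abs_sq H A))", rotated])
    show "c0_function X \<phi>" using \<phi> by (simp add: cutoff_on_def)
    fix v assume v: "v \<in> topspace X"
    have "(\<phi> v)\<^sup>2 \<le> \<bar>\<phi> v\<bar>"
      using le[OF v] by (simp add: power2_eq_square mult_left_le)
    then show "norm (htrace (fibre \<E> v) (abs_sq (fibre \<E> v) (localization X \<E> (diagonal_operator \<phi> A) v)))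
        \<le> norm (htrace H (abs_sq H A)) * norm (\<phi> v)"
      using v by (simp add: tr norm_mult mult.commute mult_right_mono del: of_real_power)
  qed
qed

text \<open>\<eta> is the sum of the sections w_h h, and the bound is the triangle inequality for
  the sum of the w_h (x - h). An estimate against arbitrary x, in place of a formula for \<eta>,
  lets the induction add one summand at a time without finite sums in the carrier.\<close>

lemma ex_weighted_sum:
  assumes M: "closed_submodule X \<E> M"
    and D: "\<And>a h. c0_function X a \<Longrightarrow> h \<in> F \<Longrightarrow> (\<lambda>v\<in>topspace X. a v \<odot> h) \<in> M"
    and F: "finite F" "F \<subseteq> carrier H"
    and w: "\<And>h. h \<in> F \<Longrightarrow> c0_function X (w h)" "\<And>h v. h \<in> F \<Longrightarrow> v \<in> topspace X \<Longrightarrow> 0 \<le> w h v"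
  shows "\<exists>\<eta>\<in>M. \<forall>v\<in>topspace X. \<forall>x\<in>carrier H.
    hdist H (complex_of_real (\<Sum>h\<in>F. w h v) \<odot> x) (\<eta> v) \<le> (\<Sum>h\<in>F. w h v * hdist H x h)"
  using F(1,2) D w
proof (induction F rule: finite_induct)
  case empty
  have "sec_zero X \<E> \<in> M"
    using M by (simp add: closed_submodule_def)
  then show ?case
    by (intro bexI[of _ "sec_zero X \<E>"]) (simp_all add: sec_zero_def)
next
  case (insert h F)
  then obtain \<eta> where \<eta>: "\<eta> \<in> M" "\<And>v x. v \<in> topspace X \<Longrightarrow> x \<in> carrier H \<Longrightarrow>
      hdist H (complex_of_real (\<Sum>h\<in>F. w h v) \<odot> x) (\<eta> v) \<le> (\<Sum>h\<in>F. w h v * hdist H x h)"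
    by auto
  define \<zeta> where "\<zeta> = (\<lambda>v\<in>topspace X. complex_of_real (w h v) \<odot> h)"
  have \<zeta>: "\<zeta> \<in> M"
    unfolding \<zeta>_def using insert.prems by (intro insert.prems(2) c0_function_of_real) auto
  have h: "h \<in> carrier H" using insert.prems by simp
  show ?case
  proof (intro bexI ballI)
    show "sec_add X \<E> \<zeta> \<eta> \<in> M"
      using M \<zeta> \<eta>(1) unfolding closed_submodule_def by blast
    fix v x assume v: "v \<in> topspace X" and x: "x \<in> carrier H"
    have "\<eta> \<in> c0_sections X \<E>"
      using M \<eta>(1) unfolding closed_submodule_def by blast
    then have \<eta>v: "\<eta> v \<in> carrier H"
      using v by (auto simp: mem_c0_sections continuous_iff)
    have "hdist H (complex_of_real (\<Sum>h\<in>insert h F. w h v) \<odot> x) (sec_add X \<E> \<zeta> \<eta> v)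
        = hdist H (complex_of_real (w h v) \<odot> x \<oplus> complex_of_real (\<Sum>h\<in>F. w h v) \<odot> x)
            (complex_of_real (w h v) \<odot> h \<oplus> \<eta> v)"
      using insert.hyps v x by (simp add: sec_add_def \<zeta>_def flip: smult_add_left)
    also have "\<dots> \<le> hdist H (complex_of_real (w h v) \<odot> x) (complex_of_real (w h v) \<odot> h)
        + hdist H (complex_of_real (\<Sum>h\<in>F. w h v) \<odot> x) (\<eta> v)"
      using x h \<eta>v by (intro hdist_add_le) auto
    also have "\<dots> \<le> w h v * hdist H x h + (\<Sum>h\<in>F. w h v * hdist H x h)"
      using \<eta>(2)[OF v x] x h v insert.prems by (simp add: hdist_smult)
    finally show "hdist H (complex_of_real (\<Sum>h\<in>insert h F. w h v) \<odot> x) (sec_add X \<E> \<zeta> \<eta> v)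
        \<le> (\<Sum>h\<in>insert h F. w h v * hdist H x h)"
      using insert.hyps by simp
  qed
qed

text \<open>A section \<open>\<xi>\<close> is approximated by \<open>\<Sum>h. (\<psi> h / q) h\<close>, where the bump \<open>\<psi> h\<close> lives on the set where \<open>\<xi>\<close>
  is \<open>\<epsilon>\<close>-close to \<open>h\<close>.  The factor \<open>\<parallel>\<xi>\<parallel>\<close> in \<open>\<psi> h\<close> makes it vanish at infinity, and the last summand
  of \<open>q\<close> makes \<open>q\<close> positive there; it is the weight of the vector 0.\<close>

lemma submodule_dense:
  assumes M: "closed_submodule X \<E> M"
    and D: "D \<subseteq> carrier H" "mtopology closure_of D = carrier H"
    and DM: "\<And>a h. c0_function X a \<Longrightarrow> h \<in> D \<Longrightarrow> (\<lambda>v\<in>topspace X. a v \<odot> h) \<in> M"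
    and \<xi>: "\<xi> \<in> c0_sections X \<E>" and e: "\<epsilon> > 0"
  shows "\<exists>\<eta>\<in>M. \<forall>v\<in>topspace X. hdist H (\<xi> v) (\<eta> v) \<le> \<epsilon>"
proof -
  have cont: "continuous_map X mtopology \<xi>" and car: "\<And>v. v \<in> topspace X \<Longrightarrow> \<xi> v \<in> carrier H"
    and c0: "c0_function X (\<lambda>v. nrm (\<xi> v))"
    using \<xi> by (auto simp: mem_c0_sections continuous_iff)
  define U where "U h = {v \<in> topspace X. hdist H (\<xi> v) h \<in> {..<\<epsilon>}}" for h
  \<comment> \<open>Where the norm of \<xi> is below \<epsilon>, the vector 0 is close enough; only
    this compact set has to be covered by sets \<open>U h\<close>.\<close>
  have "compactin X {v \<in> topspace X. \<epsilon> \<le> norm (nrm (\<xi> v))}"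
    using c0 e unfolding c0_function_def by blast
  moreover have "openin X (U h)" if "h \<in> D" for h
    unfolding U_def
    by (rule openin_continuous_map_preimage[where Y = euclideanreal], rule continuous_dist_const[OF cont])
      (use that D(1) in auto)
  moreover have "{v \<in> topspace X. \<epsilon> \<le> norm (nrm (\<xi> v))} \<subseteq> \<Union>(U ` D)"
  proof
    fix v assume "v \<in> {v \<in> topspace X. \<epsilon> \<le> norm (nrm (\<xi> v))}"
    then have v: "v \<in> topspace X" by simp
    then have "\<xi> v \<in> mtopology closure_of D"
      using car D by simp
    then obtain h where "h \<in> D" "h \<in> mball (\<xi> v) \<epsilon>"
      using e unfolding metric_closure_of by blast
    then show "v \<in> \<Union>(U ` D)"
      using v by (auto simp: U_def)
  qed
  ultimately obtain \<F> where \<F>: "finite \<F>" "\<F> \<subseteq> U ` D"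
      "{v \<in> topspace X. \<epsilon> \<le> norm (nrm (\<xi> v))} \<subseteq> \<Union>\<F>"
    using compactinD[of X _ "U ` D"] by (metis (no_types, lifting) imageE)
  then obtain F where F: "finite F" "F \<subseteq> D" and "\<F> = U ` F"
    using finite_subset_image[OF \<F>(1,2)] by blast
  with \<F>(3) have cover: "{v \<in> topspace X. \<epsilon> \<le> norm (nrm (\<xi> v))} \<subseteq> \<Union>(U ` F)"
    by simp
  define \<psi> where "\<psi> h v = max 0 (\<epsilon> - hdist H (\<xi> v) h) * nrm (\<xi> v)" for h v
  define m where "m v = max 0 (\<epsilon> - nrm (\<xi> v))" for v
  define q where "q v = (\<Sum>h\<in>F. \<psi> h v) + m v" for v
  have \<psi>0: "0 \<le> \<psi> h v" if "v \<in> topspace X" for h v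
    using car[OF that] by (simp add: \<psi>_def)
  have m0: "0 \<le> m v" for v by (simp add: m_def)
  have le_q: "\<psi> h v \<le> q v" if "v \<in> topspace X" "h \<in> F" for h v
    using member_le_sum[of h F "\<lambda>h. \<psi> h v"] that \<psi>0 F(1) m0[of v] unfolding q_def by fastforce
  have q: "q v > 0" if v: "v \<in> topspace X" for v
  proof (cases "\<epsilon> \<le> nrm (\<xi> v)")
    case True
    then obtain h where h: "h \<in> F" "v \<in> U h"
      using cover v by auto
    then have "\<psi> h v > 0"
      using True e by (auto simp: \<psi>_def U_def)
    with le_q[OF v h(1)] show ?thesis by linarith
  next
    case False
    then have "m v > 0" by (simp add: m_def)
    with \<psi>0[OF v] show ?thesis
      unfolding q_def by (simp add: add_nonneg_pos sum_nonneg)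
  qed
  have cnrm: "continuous_map X euclideanreal (\<lambda>v. nrm (\<xi> v))"
    by (rule continuous_nrm[OF cont])
  have cpsi: "continuous_map X euclideanreal (\<psi> h)" if "h \<in> F" for h
    unfolding \<psi>_def using that F D
    by (intro continuous_map_real_mult continuous_map_real_max continuous_map_diff cnrm
        continuous_dist_const[OF cont]) auto
  have cq: "continuous_map X euclideanreal q"
    unfolding q_def m_def
    by (intro continuous_map_add continuous_map_sum continuous_map_real_max continuous_map_diff cnrm cpsi F(1))
      auto
  define w where "w h v = \<psi> h v / q v" for h v
  have w0: "0 \<le> w h v" if "v \<in> topspace X" for h v
    using \<psi>0[OF that] q[OF that] by (simp add: w_def)
  have cw: "c0_function X (w h)" if h: "h \<in> F" for h
  proof (rule c0_function_dominated[OF c0])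
    show "continuous_map X euclideanreal (w h)"
      unfolding w_def using q cpsi[OF h] cq by (intro continuous_map_real_divide) (auto simp: less_le)
    fix v assume v: "v \<in> topspace X"
    note car[OF v, THEN nrm_nonneg]
    \<comment> \<open>Where the norm of \<xi> v is at most \<epsilon> / 2, m and hence q is at least
      \<epsilon> / 2, which gives the factor 2. Elsewhere w is at most 1, hence at most 2 /
      \<epsilon> times the norm. The constant is the sum of both factors.\<close>
    show "norm (w h v) \<le> (2 + 2 / \<epsilon>) * norm (nrm (\<xi> v))"
    proof (cases "nrm (\<xi> v) \<le> \<epsilon> / 2")
      case True
      have "m v \<ge> \<epsilon> / 2" using True by (auto simp: m_def max_def)
      then have q2: "q v \<ge> \<epsilon> / 2"
        using \<psi>0[OF v] unfolding q_def by (simp add: add_increasing sum_nonneg)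
      have "\<psi> h v \<le> \<epsilon> * nrm (\<xi> v)"
        unfolding \<psi>_def using e car[OF v] by (intro mult_right_mono) auto
      also have "\<dots> \<le> (2 * nrm (\<xi> v)) * q v"
        using mult_left_mono[OF q2, of "2 * nrm (\<xi> v)"] car[OF v] by (simp add: mult_ac)
      finally have "w h v \<le> 2 * nrm (\<xi> v)"
        using q[OF v] by (simp add: w_def field_simps)
      moreover have "0 \<le> 2 / \<epsilon> * nrm (\<xi> v)"
        using e car[OF v] by simp
      ultimately show ?thesis
        using w0[OF v] car[OF v] by (simp add: algebra_simps)
    next
      case False
      have "w h v \<le> 1"
        using le_q[OF v h] q[OF v] by (simp add: w_def)
      also have "1 \<le> 2 / \<epsilon> * nrm (\<xi> v)"
        using False e by (simp add: field_simps)
      also have "\<dots> \<le> (2 + 2 / \<epsilon>) * nrm (\<xi> v)"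
        using car[OF v] by (intro mult_right_mono) auto
      finally show ?thesis
        using w0[OF v] car[OF v] by simp
    qed
  qed
  have "\<exists>\<eta>\<in>M. \<forall>v\<in>topspace X. \<forall>x\<in>carrier H.
      hdist H (complex_of_real (\<Sum>h\<in>F. w h v) \<odot> x) (\<eta> v) \<le> (\<Sum>h\<in>F. w h v * hdist H x h)"
    by (rule ex_weighted_sum[OF M]) (use F D(1) DM cw w0 in auto)
  then obtain \<eta> where \<eta>: "\<eta> \<in> M" "\<And>v x. v \<in> topspace X \<Longrightarrow> x \<in> carrier H \<Longrightarrow>
      hdist H (complex_of_real (\<Sum>h\<in>F. w h v) \<odot> x) (\<eta> v) \<le> (\<Sum>h\<in>F. w h v * hdist H x h)"
    by blast
  have "hdist H (\<xi> v) (\<eta> v) \<le> \<epsilon>" if v: "v \<in> topspace X" for v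
  proof -
    define s where "s = (\<Sum>h\<in>F. w h v)"
    \<comment> \<open>1 - s is the weight of the vector 0; it is zero where the norm of \<xi>
      exceeds \<epsilon>, just as \<psi> h is zero where h is farther than \<epsilon> from \<xi>. So
      the two error terms are at most (1 - s) \<epsilon> and s \<epsilon>.\<close>
    have s: "1 - s = m v / q v"
      using q[OF v] by (simp add: s_def w_def q_def field_simps flip: sum_divide_distrib)
    have "\<eta> \<in> c0_sections X \<E>"
      using M \<eta>(1) unfolding closed_submodule_def by blast
    then have \<eta>v: "\<eta> v \<in> carrier H"
      using v by (auto simp: mem_c0_sections continuous_iff)
    have "hdist H (\<xi> v) (\<eta> v) \<le> hdist H (\<xi> v) (complex_of_real s \<odot> \<xi> v)
        + hdist H (complex_of_real s \<odot> \<xi> v) (\<eta> v)"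
      using triangle[of "\<xi> v" "complex_of_real s \<odot> \<xi> v" "\<eta> v"] car[OF v] \<eta>v by simp
    also have "hdist H (\<xi> v) (complex_of_real s \<odot> \<xi> v) = (1 - s) * nrm (\<xi> v)"
    proof -
      have "0 \<le> 1 - s"
        unfolding s using m0[of v] q[OF v] by simp
      then have "norm (1 - complex_of_real s) = 1 - s"
        using norm_of_real[of "1 - s", where 'a = complex] by simp
      then show ?thesis
        using hdist_smult_left[OF car[OF v], of 1 "complex_of_real s"] car[OF v] by simp
    qed
    also have "\<dots> \<le> (1 - s) * \<epsilon>"
    proof -
      have "m v * nrm (\<xi> v) \<le> m v * \<epsilon>"
        unfolding m_def by (cases "nrm (\<xi> v) \<le> \<epsilon>") (auto intro: mult_left_mono)
      then show ?thesis
        using q[OF v] by (simp add: s divide_right_mono)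
    qed
    also have "hdist H (complex_of_real s \<odot> \<xi> v) (\<eta> v) \<le> (\<Sum>h\<in>F. w h v * hdist H (\<xi> v) h)"
      unfolding s_def by (rule \<eta>(2)[OF v car[OF v]])
    also have "\<dots> \<le> (\<Sum>h\<in>F. w h v * \<epsilon>)"
    proof (rule sum_mono)
      fix h
      have "\<psi> h v * hdist H (\<xi> v) h \<le> \<psi> h v * \<epsilon>"
      proof (cases "hdist H (\<xi> v) h \<le> \<epsilon>")
        case True
        then show ?thesis by (intro mult_left_mono \<psi>0[OF v])
      qed (simp add: \<psi>_def)
      then show "w h v * hdist H (\<xi> v) h \<le> w h v * \<epsilon>"
        using q[OF v] by (simp add: w_def divide_right_mono)
    qed
    also have "\<dots> = s * \<epsilon>" by (simp add: s_def sum_distrib_right)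
    finally show ?thesis by (simp add: algebra_simps)
  qed
  with \<eta>(1) show ?thesis by blast
qed

text \<open>The generators are \<phi> h with \<phi> from the countable family of cutoffs and h from
  a countable dense set. A closed submodule containing them contains a h for every C_0 function a,
  as a uniform limit of sections a \<phi> h, and \<open>submodule_dense\<close> does the
  rest.\<close>

lemma const_countably_generated:
  assumes sep: "separable_space (htopology H)" and sc: "second_countable X"
  shows "countably_generated X \<E>"
proof -
  obtain D where D: "countable D" "D \<subseteq> carrier H" "mtopology closure_of D = carrier H"
    using sep unfolding separable_space_def by auto
  obtain \<Phi> where \<Phi>: "countable \<Phi>" "\<And>\<phi>. \<phi> \<in> \<Phi> \<Longrightarrow> cutoff_on X {} \<phi>"
    and \<Phi>K: "\<And>K. compactin X K \<Longrightarrow> \<exists>\<phi>\<in>\<Phi>. cutoff_on X K \<phi>"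
    using ex_countable_cutoffs[OF lc haus sc] by metis
  define S where "S = (\<lambda>(\<phi>, h). \<lambda>v\<in>topspace X. complex_of_real (\<phi> v) \<odot> h) ` (\<Phi> \<times> D)"
  have "M = c0_sections X \<E>" if M: "closed_submodule X \<E> M" and SM: "S \<subseteq> M" for M
  proof
    show "M \<subseteq> c0_sections X \<E>"
      using M by (simp add: closed_submodule_def)
    have lim: "\<xi> \<in> M" if "\<xi> \<in> c0_sections X \<E>"
      "\<And>\<epsilon>. \<epsilon> > 0 \<Longrightarrow> \<exists>\<eta>\<in>M. \<forall>v\<in>topspace X. hdist H (\<xi> v) (\<eta> v) < \<epsilon>" for \<xi>
      using M that unfolding closed_submodule_def fibre_const_bundle by blast
    have DM: "(\<lambda>v\<in>topspace X. a v \<odot> h) \<in> M" if a: "c0_function X a" and h: "h \<in> D" for a h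
    proof (rule lim)
      have hH: "h \<in> carrier H" using h D by blast
      then have h0: "nrm h \<ge> 0" by simp
      show "(\<lambda>v\<in>topspace X. a v \<odot> h) \<in> c0_sections X \<E>"
        by (rule c0_smult_const[OF a hH])
      fix \<epsilon> :: real assume e: "\<epsilon> > 0"
      \<comment> \<open>Where |a| is at least \<delta> the cutoff is 1 and there is no error;
        elsewhere the error is below \<delta> (nrm h + 1) = \<epsilon>. The summand 1 keeps the
        denominator positive for h = 0.\<close>
      define \<delta> where "\<delta> = \<epsilon> / (nrm h + 1)"
      have \<delta>: "\<delta> > 0" using e h0 by (simp add: \<delta>_def)
      then have "compactin X {v \<in> topspace X. \<delta> \<le> norm (a v)}"
        using a unfolding c0_function_def by blast
      then obtain \<phi> where \<phi>: "\<phi> \<in> \<Phi>" "cutoff_on X {v \<in> topspace X. \<delta> \<le> norm (a v)} \<phi>"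
        using \<Phi>K by metis
      define \<zeta> where "\<zeta> = (\<lambda>v\<in>topspace X. complex_of_real (\<phi> v) \<odot> h)"
      have "\<zeta> \<in> S"
        using \<phi>(1) h unfolding S_def \<zeta>_def by force
      then have "sec_scale X \<E> a \<zeta> \<in> M"
        using M SM a unfolding closed_submodule_def by blast
      moreover have "hdist H ((\<lambda>v\<in>topspace X. a v \<odot> h) v) (sec_scale X \<E> a \<zeta> v) < \<epsilon>"
        if v: "v \<in> topspace X" for v
      proof -
        have "hdist H ((\<lambda>v\<in>topspace X. a v \<odot> h) v) (sec_scale X \<E> a \<zeta> v)
            = norm (a v - a v * complex_of_real (\<phi> v)) * nrm h"
          using v hH by (simp add: sec_scale_def \<zeta>_def smult_smult hdist_smult_left)
        also have "\<dots> = norm (a v) * norm (1 - complex_of_real (\<phi> v)) * nrm h"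
          by (simp add: norm_mult[symmetric] algebra_simps)
        also have "norm (1 - complex_of_real (\<phi> v)) = 1 - \<phi> v"
          using \<phi>(2) v norm_of_real[of "1 - \<phi> v", where 'a = complex] by (simp add: cutoff_on_def)
        also have "norm (a v) * (1 - \<phi> v) * nrm h < \<epsilon>"
        proof (cases "\<delta> \<le> norm (a v)")
          case True
          then show ?thesis using \<phi>(2) v e by (simp add: cutoff_on_def)
        next
          case False
          have "norm (a v) * (1 - \<phi> v) * nrm h \<le> norm (a v) * 1 * (nrm h + 1)"
            using \<phi>(2) v h0 by (intro mult_mono) (auto simp: cutoff_on_def)
          also have "\<dots> < \<delta> * (nrm h + 1)"
            using False h0 by simp
          also have "\<dots> = \<epsilon>" using h0 by (simp add: \<delta>_def)
          finally show ?thesis .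
        qed
        finally show ?thesis .
      qed
      ultimately show "\<exists>\<eta>\<in>M. \<forall>v\<in>topspace X. hdist H ((\<lambda>v\<in>topspace X. a v \<odot> h) v) (\<eta> v) < \<epsilon>"
        by blast
    qed
    show "c0_sections X \<E> \<subseteq> M"
    proof
      fix \<xi> assume \<xi>: "\<xi> \<in> c0_sections X \<E>"
      show "\<xi> \<in> M"
      proof (rule lim[OF \<xi>])
        fix \<epsilon> :: real assume "\<epsilon> > 0"
        \<comment> \<open>\<open>submodule_dense\<close> gives a weak inequality and
          \<open>closed_submodule\<close> asks for a strict one, hence \<epsilon> / 2.\<close>
        then obtain \<eta> where \<eta>: "\<eta> \<in> M" "\<And>v. v \<in> topspace X \<Longrightarrow> hdist H (\<xi> v) (\<eta> v) \<le> \<epsilon> / 2"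
          using submodule_dense[OF M D(2,3) DM \<xi>, of "\<epsilon> / 2"] by auto
        with \<open>\<epsilon> > 0\<close> show "\<exists>\<eta>\<in>M. \<forall>v\<in>topspace X. hdist H (\<xi> v) (\<eta> v) < \<epsilon>"
          by (intro bexI[OF _ \<eta>(1)]) force
      qed
    qed
  qed
  moreover have "countable S"
    unfolding S_def using D(1) \<Phi>(1) by auto
  moreover have "S \<subseteq> c0_sections X \<E>"
    unfolding S_def using \<Phi>(2) D(2)
    by (auto intro!: c0_smult_const c0_function_of_real simp: cutoff_on_def)
  ultimately show ?thesis
    unfolding countably_generated_def by blast
qed

end

section \<open>Groupoids with a section of the range map\<close>

lemma topspace_isotropy [simp]: "gset (isotropy G u) = {x \<in> gset G. grng G x = u \<and> gdom G x = u}"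
  by (auto simp: isotropy_def range_fibre_def domain_fibre_def)

lemma isotropy_simps [simp]:
  "grng (isotropy G u) = grng G" "gdom (isotropy G u) = gdom G" "gmul (isotropy G u) = gmul G"
  "ginv (isotropy G u) = ginv G"
  by (simp_all add: isotropy_def)

locale groupoid_section =
  fixes G :: "'g tgroupoid" and u :: 'g and gam :: "'g \<Rightarrow> 'g"
  assumes groupoid: "topological_groupoid G" and u: "u \<in> units G"
    and gam_cont: "continuous_map (unit_space G) (subtopology (gtop G) (domain_fibre G u)) gam"
    and gam_rng: "\<forall>v\<in>units G. grng G (gam v) = v"
begin

lemma units: "v \<in> units G \<Longrightarrow> v \<in> gset G" "v \<in> units G \<Longrightarrow> grng G v = v" "v \<in> units G \<Longrightarrow> gdom G v = v"
  using groupoid unfolding topological_groupoid_def by blast+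

lemma grng_units: "x \<in> gset G \<Longrightarrow> grng G x \<in> units G"
  using groupoid unfolding topological_groupoid_def by blast

lemma gdom_units: "x \<in> gset G \<Longrightarrow> gdom G x \<in> units G"
  by (simp add: units_def)

lemma gmul:
  assumes "x \<in> gset G" "y \<in> gset G" "gdom G x = grng G y"
  shows "gmul G x y \<in> gset G" "grng G (gmul G x y) = grng G x" "gdom G (gmul G x y) = gdom G y"
  using assms groupoid unfolding topological_groupoid_def composable_def by auto

lemma gmul_assoc:
  assumes "x \<in> gset G" "y \<in> gset G" "z \<in> gset G" "gdom G x = grng G y" "gdom G y = grng G z"
  shows "gmul G (gmul G x y) z = gmul G x (gmul G y z)"
proof -
  have "\<forall>x y z. (x, y) \<in> composable G \<and> (y, z) \<in> composable G \<longrightarrow>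
      gmul G (gmul G x y) z = gmul G x (gmul G y z)"
    using groupoid unfolding topological_groupoid_def by argo
  then show ?thesis
    using assms by (simp add: composable_def)
qed

lemma gmul_unit: "x \<in> gset G \<Longrightarrow> gmul G (grng G x) x = x" "x \<in> gset G \<Longrightarrow> gmul G x (gdom G x) = x"
  using groupoid unfolding topological_groupoid_def by blast+

lemma ginv:
  assumes "x \<in> gset G"
  shows "ginv G x \<in> gset G" "grng G (ginv G x) = gdom G x" "gdom G (ginv G x) = grng G x"
    "gmul G x (ginv G x) = grng G x" "gmul G (ginv G x) x = gdom G x"
  using groupoid assms unfolding topological_groupoid_def by blast+

lemma topspace_unit_space [simp]: "topspace (unit_space G) = units G"
  using units by (auto simp: unit_space_def)

lemma gam:
  assumes "v \<in> units G"
  shows "gam v \<in> gset G" "gdom G (gam v) = u" "grng G (gam v) = v"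
proof -
  have "gam v \<in> topspace (subtopology (gtop G) (domain_fibre G u))"
    using continuous_map_image_subset_topspace[OF gam_cont] assms by auto
  then show "gam v \<in> gset G" "gdom G (gam v) = u"
    by (auto simp: domain_fibre_def)
  show "grng G (gam v) = v"
    using gam_rng assms by blast
qed

lemma continuous_gmul:
  assumes "continuous_map X (gtop G) f" "continuous_map X (gtop G) g"
    and "\<And>x. x \<in> topspace X \<Longrightarrow> gdom G (f x) = grng G (g x)"
  shows "continuous_map X (gtop G) (\<lambda>x. gmul G (f x) (g x))"
proof -
  have "continuous_map X (subtopology (prod_topology (gtop G) (gtop G)) (composable G)) (\<lambda>x. (f x, g x))"
    using assms continuous_map_image_subset_topspace[OF assms(1)] continuous_map_image_subset_topspace[OF assms(2)]
    by (auto simp: continuous_map_in_subtopology composable_def image_subset_iff intro!: continuous_map_pairedI)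
  moreover have "continuous_map (subtopology (prod_topology (gtop G) (gtop G)) (composable G)) (gtop G)
      (\<lambda>(x, y). gmul G x y)"
    using groupoid unfolding topological_groupoid_def by argo
  ultimately show ?thesis
    using continuous_map_compose by (fastforce simp: o_def)
qed

lemma continuous_ginv:
  assumes "continuous_map X (gtop G) f"
  shows "continuous_map X (gtop G) (\<lambda>x. ginv G (f x))"
proof -
  have "continuous_map (gtop G) (gtop G) (ginv G)"
    using groupoid unfolding topological_groupoid_def by argo
  with continuous_map_compose[OF assms] show ?thesis
    by (simp add: o_def)
qed

text \<open>\<open>topological_groupoid\<close> demands continuity of multiplication and inversion;
  the range map inherits it from r(x) = x x^-1, and the domain map likewise from d(x) = x^-1
  x.\<close>

lemma continuous_grng: "continuous_map (gtop G) (unit_space G) (grng G)"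
proof -
  have "continuous_map (gtop G) (gtop G) (\<lambda>x. gmul G x (ginv G x))"
    by (intro continuous_gmul continuous_ginv) (auto simp: ginv)
  then have "continuous_map (gtop G) (gtop G) (grng G)"
    by (rule continuous_map_eq) (simp add: ginv)
  then show ?thesis
    by (auto simp: unit_space_def continuous_map_in_subtopology grng_units)
qed

lemma continuous_gdom: "continuous_map (gtop G) (unit_space G) (gdom G)"
proof -
  have "continuous_map (gtop G) (gtop G) (\<lambda>x. gmul G (ginv G x) x)"
    by (intro continuous_gmul continuous_ginv) (auto simp: ginv)
  then have "continuous_map (gtop G) (gtop G) (gdom G)"
    by (rule continuous_map_eq) (simp add: ginv)
  then show ?thesis
    by (auto simp: unit_space_def continuous_map_in_subtopology gdom_units)
qed

text \<open>Units are the fixed points of the domain map, and the equaliser of continuous maps into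
  a Hausdorff space is closed. Closedness passes local compactness on to the unit space.\<close>

lemma closedin_units:
  assumes "Hausdorff_space (gtop G)"
  shows "closedin (gtop G) (units G)"
proof -
  have "continuous_map (gtop G) (gtop G) (gdom G)"
    using continuous_gdom by (simp add: unit_space_def continuous_map_in_subtopology)
  then have "closedin (gtop G) {x \<in> gset G. gdom G x = x}"
    by (rule closedin_continuous_maps_eq[OF assms]) simp
  moreover have "x \<in> units G" if "x \<in> gset G" "gdom G x = x" for x
    using gdom_units[OF that(1)] that(2) by simp
  then have "{x \<in> gset G. gdom G x = x} = units G"
    by (auto simp: units)
  ultimately show ?thesis by simp
qed

text \<open>On the isotropy group at u this is conjugation by \<open>gam u\<close>, so it is the
  identity there only up to an inner automorphism.\<close>

definition retract :: "'g \<Rightarrow> 'g" where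
  "retract x = gmul G (gmul G (ginv G (gam (grng G x))) x) (gam (gdom G x))"

lemma retract_in:
  assumes x: "x \<in> gset G"
  shows "retract x \<in> gset G" "grng G (retract x) = u" "gdom G (retract x) = u"
  using x by (simp_all add: retract_def gmul ginv gam grng_units gdom_units)

text \<open>Between the two factors stand \<gamma>(d(x)) and the inverse of \<gamma>(r(y)), which
  cancel because d(x) = r(y).\<close>

lemma retract_gmul:
  assumes x: "x \<in> gset G" and y: "y \<in> gset G" and xy: "gdom G x = grng G y"
  shows "retract (gmul G x y) = gmul G (retract x) (retract y)"
proof -
  note s = x y xy gmul ginv gam grng_units gdom_units gmul_assoc
  define a where "a = gmul G (ginv G (gam (grng G x))) x"
  define b where "b = gam (grng G y)"
  define f where "f = gam (gdom G y)"
  have a: "a \<in> gset G" "gdom G a = grng G y" using s by (simp_all add: a_def)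
  have b: "b \<in> gset G" "gdom G b = u" "grng G b = grng G y" using s by (simp_all add: b_def)
  have f: "f \<in> gset G" "gdom G f = u" "grng G f = gdom G y" using s by (simp_all add: f_def)
  have "gmul G (retract x) (retract y) = gmul G (gmul G a b) (gmul G (gmul G (ginv G b) y) f)"
    using xy by (simp add: retract_def a_def b_def f_def)
  also have "\<dots> = gmul G a (gmul G (gmul G (gmul G b (ginv G b)) y) f)"
    using a b f y by (simp add: gmul ginv(1-3) gmul_assoc)
  also have "\<dots> = gmul G a (gmul G y f)"
    using b y by (simp add: ginv(4) gmul_unit)
  also have "\<dots> = gmul G (gmul G a y) f"
    using a f y by (simp add: gmul_assoc)
  also have "\<dots> = retract (gmul G x y)"
    using s by (simp add: a_def f_def retract_def)
  finally show ?thesis by simp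
qed

lemma retract_unit:
  assumes v: "v \<in> units G"
  shows "retract v = u"
proof -
  have "gmul G (ginv G (gam v)) v = ginv G (gam v)"
    using gmul_unit(2)[of "ginv G (gam v)"] v by (simp add: ginv gam)
  then show ?thesis
    using v by (simp add: retract_def units gam ginv)
qed

text \<open>Applying \<pi> turns this into the intertwining relation.\<close>

lemma gam_retract:
  assumes x: "x \<in> gset G" and r: "grng G x = u" and d: "gdom G x = u"
  shows "gmul G (gam u) (retract x) = gmul G x (gam u)"
proof -
  have "gmul G (gam u) (retract x) = gmul G (gmul G (gmul G (gam u) (ginv G (gam u))) x) (gam u)"
    using x r d u by (simp add: retract_def gmul ginv(1-3) gam gmul_assoc)
  also have "\<dots> = gmul G x (gam u)"
    using x u gmul_unit(1)[OF x] r by (simp add: ginv(4) gam)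
  finally show ?thesis .
qed

lemma continuous_retract: "continuous_map (gtop G) (gtop (isotropy G u)) retract"
proof -
  have gam: "continuous_map (unit_space G) (gtop G) gam"
    using gam_cont by (simp add: continuous_map_in_subtopology)
  have "continuous_map (gtop G) (gtop G) retract"
    unfolding retract_def
    using continuous_map_compose[OF continuous_grng gam] continuous_map_compose[OF continuous_gdom gam]
    by (intro continuous_gmul continuous_ginv)
      (simp_all add: o_def gmul ginv groupoid_section.gam[OF groupoid_section_axioms] grng_units gdom_units)
  then show ?thesis
    using retract_in
    by (auto simp: isotropy_def continuous_map_in_subtopology range_fibre_def domain_fibre_def)
qed

lemma units_isotropy [simp]: "units (isotropy G u) = {u}"
  using u units[OF u] by (force simp: units_def[of "isotropy G u"])

lemma topspace_unit_space_isotropy [simp]: "topspace (unit_space (isotropy G u)) = {u}"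
  using u units[OF u] by (auto simp: unit_space_def)

end

section \<open>Extending a representation of the isotropy group\<close>

locale groupoid_rep = groupoid_section G u gam
  for G :: "'g tgroupoid" and u :: 'g and gam :: "'g \<Rightarrow> 'g" +
  fixes E :: "('g, 'h) hilbert_bundle" and \<pi> :: "'g \<Rightarrow> 'h \<Rightarrow> 'h"
  assumes sc: "second_countable (gtop G)" and lc: "locally_compact_space (gtop G)"
    and haus: "Hausdorff_space (gtop G)" and rep: "unitary_rep (isotropy G u) E \<pi>"
begin

abbreviation H where "H \<equiv> fibre E u"
abbreviation X where "X \<equiv> unit_space G"
abbreviation Xu where "Xu \<equiv> unit_space (isotropy G u)"

lemma fibre_bundle: "continuous_hilbert_bundle Xu E"
  using rep by (simp add: unitary_rep_def)

lemma locally_compact_X: "locally_compact_space X"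
  using locally_compact_space_closed_subset[OF lc closedin_units[OF haus]] by (simp add: unit_space_def)

lemma Hausdorff_X: "Hausdorff_space X"
  using haus by (simp add: unit_space_def Hausdorff_space_subtopology)

sublocale hilbert_over H X
proof
  show "hilbert_space H"
    using fibre_bundle by (simp add: continuous_hilbert_bundle_def)
qed (rule locally_compact_X Hausdorff_X)+

lemma separable: "separable_space (htopology H)"
  using fibre_bundle by (simp add: continuous_hilbert_bundle_def)

text \<open>A bundle guarantees only that the values of continuous sections are dense in a fibre.
  Over a point, completeness under locally uniform approximation then yields every vector exactly,
  and the decay condition is automatic because the base is compact.\<close>

lemma point_section:
  assumes h: "h \<in> carrier H"
  shows "(\<lambda>v\<in>{u}. h) \<in> c0_sections Xu E"
proof -
  have "\<forall>\<xi>\<in>(\<Pi>\<^sub>E v\<in>topspace Xu. carrier (fibre E v)).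
      (\<forall>v\<in>topspace Xu. \<forall>\<epsilon>>0. \<exists>\<eta>\<in>cts_sections E. \<exists>U. openin Xu U \<and> v \<in> U \<and>
           (\<forall>w\<in>U. hdist (fibre E w) (\<xi> w) (\<eta> w) < \<epsilon>)) \<longrightarrow> \<xi> \<in> cts_sections E"
    using fibre_bundle unfolding continuous_hilbert_bundle_def by argo
  moreover have "(\<lambda>v\<in>{u}. h) \<in> (\<Pi>\<^sub>E v\<in>topspace Xu. carrier (fibre E v))"
    using h by auto
  moreover have "\<exists>\<eta>\<in>cts_sections E. \<exists>U. openin Xu U \<and> v \<in> U \<and>
      (\<forall>w\<in>U. hdist (fibre E w) ((\<lambda>v\<in>{u}. h) w) (\<eta> w) < \<epsilon>)"
    if v: "v \<in> topspace Xu" and \<epsilon>: "\<epsilon> > 0" for v \<epsilon>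
  proof -
    have "htopology H closure_of ((\<lambda>\<xi>. \<xi> u) ` cts_sections E) = carrier H"
      using fibre_bundle by (simp add: continuous_hilbert_bundle_def)
    then have "h \<in> htopology H closure_of ((\<lambda>\<xi>. \<xi> u) ` cts_sections E)"
      using h by simp
    then obtain \<eta> where "\<eta> \<in> cts_sections E" "\<eta> u \<in> mball h \<epsilon>"
      using \<epsilon> unfolding metric_closure_of by blast
    moreover have "openin Xu {u}"
      using openin_topspace[of Xu] by simp
    ultimately show ?thesis
      using v by (intro bexI exI[of _ "{u}"]) auto
  qed
  ultimately have cts: "(\<lambda>v\<in>{u}. h) \<in> cts_sections E"
    by simp
  have "continuous_map Xu euclideanreal (\<lambda>v. hnorm (fibre E v) ((\<lambda>v\<in>{u}. h) v))"
    using fibre_bundle cts unfolding continuous_hilbert_bundle_def by blast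
  then have "c0_function Xu (\<lambda>v. hnorm (fibre E v) ((\<lambda>v\<in>{u}. h) v))"
    unfolding c0_function_def by (auto intro!: finite_imp_compactin)
  with cts show ?thesis
    by (simp add: c0_sections_def)
qed

lemma point_section_value:
  assumes "\<xi> \<in> c0_sections Xu E"
  shows "\<xi> u \<in> carrier H"
  using assms fibre_bundle unfolding c0_sections_def continuous_hilbert_bundle_def by (auto simp: PiE_def Pi_def)

text \<open>B is the localization of an adjoint S of T. The sections picked by \<open>SOME\<close>
  take the prescribed values at u, so the identity for sections becomes one for vectors.\<close>

lemma adjoint_localization:
  assumes "adjointable Xu E T"
  obtains B where "mutually_adjoint (localization Xu E T u) B"
proof -
  obtain S where S: "S ` c0_sections Xu E \<subseteq> c0_sections Xu E"
      "\<And>\<xi> \<eta>. \<xi> \<in> c0_sections Xu E \<Longrightarrow> \<eta> \<in> c0_sections Xu E \<Longrightarrow>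
        hinner (fibre E u) (T \<xi> u) (\<eta> u) = hinner (fibre E u) (\<xi> u) (S \<eta> u)"
    and T: "T ` c0_sections Xu E \<subseteq> c0_sections Xu E"
    using assms unfolding adjointable_def by auto
  have ch: "(SOME \<xi>. \<xi> \<in> c0_sections Xu E \<and> \<xi> u = h) \<in> c0_sections Xu E"
      "(SOME \<xi>. \<xi> \<in> c0_sections Xu E \<and> \<xi> u = h) u = h" if "h \<in> carrier H" for h
    using someI[of "\<lambda>\<xi>. \<xi> \<in> c0_sections Xu E \<and> \<xi> u = h" "\<lambda>v\<in>{u}. h"] point_section[OF that] by simp_all
  have "mutually_adjoint (localization Xu E T u) (localization Xu E S u)"
    unfolding mutually_adjoint_def
  proof (intro conjI ballI)
    fix x assume x: "x \<in> carrier H"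
    show "localization Xu E T u x \<in> carrier H" "localization Xu E S u x \<in> carrier H"
      using point_section_value[OF subsetD[OF T imageI[OF ch(1)[OF x]]]]
        point_section_value[OF subsetD[OF S(1) imageI[OF ch(1)[OF x]]]] x
      by (simp_all add: localization_def)
    fix y assume y: "y \<in> carrier H"
    show "ip (localization Xu E T u x) y = ip x (localization Xu E S u y)"
      using S(2)[of "SOME \<xi>. \<xi> \<in> c0_sections Xu E \<and> \<xi> u = x" "SOME \<xi>. \<xi> \<in> c0_sections Xu E \<and> \<xi> u = y"]
        ch(1)[OF x] ch(1)[OF y] ch(2)[OF x] ch(2)[OF y] x y by (simp add: localization_def)
  qed
  then show thesis by (rule that)
qed

lemma unitary: "g \<in> gset (isotropy G u) \<Longrightarrow> unitary_map H H (\<pi> g)"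
  using rep unfolding unitary_rep_def by auto

lemma rep_unit: "h \<in> carrier H \<Longrightarrow> \<pi> u h = h"
  using rep unfolding unitary_rep_def by auto

lemma rep_gmul:
  assumes "g \<in> gset (isotropy G u)" "k \<in> gset (isotropy G u)" "h \<in> carrier H"
  shows "\<pi> (gmul G g k) h = \<pi> g (\<pi> k h)"
proof -
  have "\<forall>(x, y)\<in>composable (isotropy G u). \<forall>h\<in>carrier (fibre E (gdom (isotropy G u) y)).
      \<pi> (gmul (isotropy G u) x y) h = \<pi> x (\<pi> y h)"
    using rep unfolding unitary_rep_def by argo
  moreover have "(g, k) \<in> composable (isotropy G u)"
    using assms by (auto simp: composable_def)
  ultimately show ?thesis
    using assms by fastforce
qed

lemma rep_ginv:
  "g \<in> gset (isotropy G u) \<Longrightarrow> h \<in> carrier H \<Longrightarrow> \<pi> (ginv G g) h = inv_into (carrier H) (\<pi> g) h"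
  using rep unfolding unitary_rep_def by auto

lemma weakly_continuous:
  assumes h: "h \<in> carrier H" and k: "k \<in> carrier H"
  shows "continuous_map (gtop (isotropy G u)) euclidean (\<lambda>g. ip (\<pi> g h) k)"
proof -
  have "\<forall>\<xi>\<in>c0_sections Xu E. \<forall>\<eta>\<in>c0_sections Xu E. continuous_map (gtop (isotropy G u)) euclidean
      (\<lambda>x. hinner (fibre E (grng (isotropy G u) x)) (\<pi> x (\<xi> (gdom (isotropy G u) x)))
        (\<eta> (grng (isotropy G u) x)))"
    using rep unfolding unitary_rep_def by argo
  from this[rule_format, OF point_section[OF h] point_section[OF k]] show ?thesis
    by (rule continuous_map_eq) auto
qed

section \<open>The extended representation\<close>

definition \<pi>' :: "'g \<Rightarrow> 'h \<Rightarrow> 'h" where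
  "\<pi>' x = \<pi> (retract x)"

lemma retract_isotropy: "x \<in> gset G \<Longrightarrow> retract x \<in> gset (isotropy G u)"
  by (simp add: retract_in)

lemma unitary': "x \<in> gset G \<Longrightarrow> unitary_map H H (\<pi>' x)"
  by (simp add: \<pi>'_def unitary retract_in)

lemma rep'_gmul:
  assumes "x \<in> gset G" "y \<in> gset G" "gdom G x = grng G y" "h \<in> carrier H"
  shows "\<pi>' (gmul G x y) h = \<pi>' x (\<pi>' y h)"
  using assms rep_gmul[OF retract_isotropy retract_isotropy] by (simp add: \<pi>'_def retract_gmul)

lemma rep'_unit: "v \<in> units G \<Longrightarrow> h \<in> carrier H \<Longrightarrow> \<pi>' v h = h"
  by (simp add: \<pi>'_def retract_unit rep_unit)

text \<open>Multiplicativity and the unit law show that \<open>\<pi>' (ginv G x) h\<close> is a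
  preimage of h; injectivity makes it the one that \<open>inv_into\<close> selects.\<close>

lemma rep'_ginv:
  assumes x: "x \<in> gset G" and h: "h \<in> carrier H"
  shows "\<pi>' (ginv G x) h = inv_into (carrier H) (\<pi>' x) h"
proof (rule inv_into_f_eq[symmetric])
  show "inj_on (\<pi>' x) (carrier H)" "\<pi>' (ginv G x) h \<in> carrier H"
    using unitary_mapD[OF unitary'] x h by (auto simp: ginv)
  show "\<pi>' x (\<pi>' (ginv G x) h) = h"
    using rep'_gmul[of x "ginv G x" h] x h rep'_unit[OF grng_units[OF x] h] by (simp add: ginv)
qed

lemma unitary_rep': "unitary_rep G \<E> \<pi>'"
  unfolding unitary_rep_def fibre_const_bundle
proof (intro conjI ballI)
  show "continuous_hilbert_bundle X \<E>"
    by (rule const_hilbert_bundle[OF separable])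
  show "carrier H \<noteq> {\<zero>\<^bsub>H\<^esub>}"
    using rep by (auto simp: unitary_rep_def)
  show "countably_generated X \<E>"
    using const_countably_generated[OF separable] sc
    by (simp add: unit_space_def second_countable_subtopology)
  show "unitary_map H H (\<pi>' x)" if "x \<in> gset G" for x
    by (rule unitary'[OF that])
  show "\<pi>' v h = h" if "v \<in> units G" "h \<in> carrier H" for v h
    by (rule rep'_unit[OF that])
  show "case p of (x, y) \<Rightarrow> \<forall>h\<in>carrier H. \<pi>' (gmul G x y) h = \<pi>' x (\<pi>' y h)"
    if "p \<in> composable G" for p
    using that by (auto simp: composable_def rep'_gmul)
  show "\<pi>' (ginv G x) h = inv_into (carrier H) (\<pi>' x) h" if "x \<in> gset G" "h \<in> carrier H" for x h
    by (rule rep'_ginv[OF that])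
  fix \<xi> \<eta> assume "\<xi> \<in> c0_sections X \<E>" "\<eta> \<in> c0_sections X \<E>"
  then have \<xi>: "continuous_map X (htopology H) \<xi>" and \<eta>: "continuous_map X (htopology H) \<eta>"
    by (auto simp: mem_c0_sections)
  have c: "continuous_map (gtop G) (htopology H) (\<lambda>x. \<xi> (gdom G x))"
      "continuous_map (gtop G) (htopology H) (\<lambda>x. \<eta> (grng G x))"
    using continuous_map_compose[OF continuous_gdom \<xi>] continuous_map_compose[OF continuous_grng \<eta>]
    by (simp_all add: o_def)
  \<comment> \<open>Continuity for fixed vectors is pulled back along \<open>retract\<close>;
    \<open>continuous_ip_unitary\<close> then passes to sections.\<close>
  have weak: "continuous_map (gtop G) euclidean (\<lambda>x. ip (\<pi>' x h) k)"
    if "h \<in> carrier H" "k \<in> carrier H" for h k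
    using continuous_map_compose[OF continuous_retract weakly_continuous[OF that]]
    by (simp add: o_def \<pi>'_def)
  show "continuous_map (gtop G) euclidean (\<lambda>x. ip (\<pi>' x (\<xi> (gdom G x))) (\<eta> (grng G x)))"
    by (rule continuous_ip_unitary[OF c unitary' weak])
qed

lemma unitarily_equivalent: "unitarily_equivalent_at G u \<E> \<pi>' E \<pi>"
  unfolding unitarily_equivalent_at_def fibre_const_bundle
proof (intro exI conjI ballI)
  \<comment> \<open>\<open>gam u\<close> has range and domain u, so it lies in the group on which
    \<pi> is a representation.\<close>
  have gu: "gam u \<in> gset (isotropy G u)"
    using u by (simp add: gam)
  then show "unitary_map H H (\<pi> (gam u))"
    by (rule unitary)
  fix x h assume x: "x \<in> gset (isotropy G u)" and h: "h \<in> carrier H"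
  then have "\<pi> (gam u) (\<pi>' x h) = \<pi> (gmul G (gam u) (retract x)) h"
    using rep_gmul[OF gu retract_isotropy h] by (simp add: \<pi>'_def)
  also have "\<dots> = \<pi> x (\<pi> (gam u) h)"
    using x rep_gmul[OF x gu h] by (simp add: gam_retract)
  finally show "\<pi> (gam u) (\<pi>' x h) = \<pi> x (\<pi> (gam u) h)" .
qed

section \<open>Transport of the amenability net\<close>

lemma hs_norm_diagonal:
  assumes T: "adjointable Xu E T" and v: "v \<in> units G"
  shows "hs_norm H (localization X \<E> (diagonal_operator \<phi> (localization Xu E T u)) v)
    = \<bar>\<phi> v\<bar> * hs_norm H (localization Xu E T u)"
proof -
  obtain B where B: "mutually_adjoint (localization Xu E T u) B"
    using adjoint_localization[OF T] by blast
  show ?thesis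
    by (rule hs_norm_scaled[OF B localization_diagonal_operator[where v = v and \<phi> = \<phi>
        and A = "localization Xu E T u"]]) (use v in auto)
qed

text \<open>Translating the operator at d(x) by x amounts to translating A by
  \<open>retract x\<close> inside the isotropy group, up to the scalar \<phi>(d(x)). The second
  operator contributes \<phi>(r(x)).\<close>

lemma hs_inner_diagonal:
  assumes T: "adjointable Xu E T" and x: "x \<in> gset G"
  defines "A \<equiv> localization Xu E T u"
  shows "hs_inner H (translate G \<pi>' x (localization X \<E> (diagonal_operator \<phi> A) (gdom G x)))
      (localization X \<E> (diagonal_operator \<phi> A) (grng G x))
    = complex_of_real (\<phi> (gdom G x) * \<phi> (grng G x)) *
      hs_inner H (translate (isotropy G u) \<pi> (retract x) A) A"
proof -
  obtain B where B: "mutually_adjoint A B"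
    unfolding A_def using adjoint_localization[OF T] by blast
  note V = unitary_mapD[OF unitary'[OF x]] unitary_mapD(1)[OF unitary'[of "ginv G x"]]
  \<comment> \<open>The two translates use \<pi> at the inverse of \<open>retract x\<close> and
    \<pi>' at the inverse of x; both are the inverse of the same unitary.\<close>
  have inv: "\<pi> (ginv G (retract x)) h = \<pi>' (ginv G x) h" if "h \<in> carrier H" for h
    using rep_ginv[OF retract_isotropy[OF x] that] rep'_ginv[OF x that] by (simp add: \<pi>'_def)
  show ?thesis
  proof (rule hs_inner_scaled[OF B localization_diagonal_operator[where v = "grng G x"
        and \<phi> = \<phi> and A = A]])
    show "grng G x \<in> topspace X" using x by (simp add: grng_units)
    fix h assume h: "h \<in> carrier H"
    have inv_h: "\<pi>' (ginv G x) h \<in> carrier H"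
      using V(6) x h by (simp add: ginv)
    then have Ah: "A (\<pi>' (ginv G x) h) \<in> carrier H"
      by (rule mutually_adjointD(1)[OF B])
    show "translate (isotropy G u) \<pi> (retract x) A h \<in> carrier H"
      using h V(1)[OF Ah] by (simp add: translate_def inv flip: \<pi>'_def)
    show "translate G \<pi>' x (localization X \<E> (diagonal_operator \<phi> A) (gdom G x)) h
        = complex_of_real (\<phi> (gdom G x)) \<odot>\<^bsub>H\<^esub> translate (isotropy G u) \<pi> (retract x) A h"
      using h x inv_h V(3)[OF Ah]
      by (simp add: translate_def localization_diagonal_operator gdom_units inv flip: \<pi>'_def)
  qed assumption
qed

lemma amenability_net':
  assumes net: "amenability_net (isotropy G u) E \<pi> I leq T"
  defines "bump \<equiv> \<lambda>C. SOME \<phi>. cutoff_on X C \<phi>"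
  shows "amenability_net G \<E> \<pi>' (I \<times> {K. compactin X K}) (\<lambda>p q. leq (fst p) (fst q) \<and> snd p \<subseteq> snd q)
    (\<lambda>p. diagonal_operator (bump (snd p)) (localization Xu E (T (fst p)) u))"
  unfolding amenability_net_def fibre_const_bundle
proof (intro conjI ballI)
  let ?A = "\<lambda>i. localization Xu E (T i) u"
  \<comment> \<open>The unit space of the isotropy group is {u}, so the supremum in the hypothesis
    is the value at u; this is \<open>le1\<close>.\<close>
  have dir: "directed_index I leq"
    and hs: "\<And>i. i \<in> I \<Longrightarrow> hilbert_schmidt Xu E (T i)"
    and le1: "\<And>i. i \<in> I \<Longrightarrow> hs_norm H (?A i) \<le> 1"
    and norm1: "net_to_one_on_compacts Xu I leq (\<lambda>i v. hs_norm (fibre E v) (localization Xu E (T i) v))"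
    and inner1: "net_to_one_on_compacts (gtop (isotropy G u)) I leq
       (\<lambda>i x. hs_inner (fibre E (grng G x))
          (translate (isotropy G u) \<pi> x (localization Xu E (T i) (gdom G x)))
          (localization Xu E (T i) (grng G x)))"
    using net by (auto simp: amenability_net_def)
  have adj: "adjointable Xu E (T i)" if "i \<in> I" for i
    using hs[OF that] by (simp add: hilbert_schmidt_def)
  have bump: "cutoff_on X K (bump K)" if "compactin X K" for K
    unfolding bump_def by (rule someI_ex[OF ex_cutoff_on[OF locally_compact_X Hausdorff_X that]])
  have bump01: "0 \<le> bump K v \<and> bump K v \<le> 1" if "compactin X K" "v \<in> units G" for K v
    using bump[OF that(1)] that(2) by (simp add: cutoff_on_def)
  have bump1: "bump K v = 1" if "compactin X K" "v \<in> K" for K v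
    using bump[OF that(1)] that(2) by (simp add: cutoff_on_def)
  have reflI: "leq i i" if "i \<in> I" for i
    using dir that by (auto simp: directed_index_def reflp_on_def)
  show "directed_index (I \<times> {K. compactin X K}) (\<lambda>p q. leq (fst p) (fst q) \<and> snd p \<subseteq> snd q)"
    unfolding directed_index_def
  proof (intro conjI ballI)
    show "I \<times> {K. compactin X K} \<noteq> {}"
      using dir by (auto simp: directed_index_def intro: compactin_empty)
    show "reflp_on (I \<times> {K. compactin X K}) (\<lambda>p q. leq (fst p) (fst q) \<and> snd p \<subseteq> snd q)"
      by (intro reflp_onI) (auto simp: reflI)
    have "leq i k" if "leq i j" "leq j k" "i \<in> I" "j \<in> I" "k \<in> I" for i j k
      using dir that unfolding directed_index_def transp_on_def by blast
    then show "transp_on (I \<times> {K. compactin X K}) (\<lambda>p q. leq (fst p) (fst q) \<and> snd p \<subseteq> snd q)"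
      by (intro transp_onI) (auto 0 3)
    fix p q assume p: "p \<in> I \<times> {K. compactin X K}" and q: "q \<in> I \<times> {K. compactin X K}"
    then obtain k where "k \<in> I" "leq (fst p) k" "leq (fst q) k"
      using dir by (force simp: directed_index_def)
    then show "\<exists>r\<in>I \<times> {K. compactin X K}. (leq (fst p) (fst r) \<and> snd p \<subseteq> snd r) \<and>
        leq (fst q) (fst r) \<and> snd q \<subseteq> snd r"
      using p q by (intro bexI[of _ "(k, snd p \<union> snd q)"]) (auto intro: compactin_Un)
  qed
  show "hilbert_schmidt X \<E> (diagonal_operator (bump (snd p)) (?A (fst p)))"
    if "p \<in> I \<times> {K. compactin X K}" for p
  proof -
    from that have i: "fst p \<in> I" and K: "compactin X (snd p)" by auto
    obtain B where "mutually_adjoint (?A (fst p)) B"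
      using adjoint_localization[OF adj[OF i]] by blast
    then show ?thesis
      using hs[OF i] cutoff_on_mono[OF bump[OF K]]
      by (intro hilbert_schmidt_diagonal_operator) (auto simp: hilbert_schmidt_def)
  qed
  show "(SUP v\<in>units G. hs_norm H (localization X \<E> (diagonal_operator (bump (snd p)) (?A (fst p))) v)) \<le> 1"
    if "p \<in> I \<times> {K. compactin X K}" for p
  proof (rule cSUP_least)
    show "units G \<noteq> {}" using u by blast
    fix v assume v: "v \<in> units G"
    from that have i: "fst p \<in> I" and K: "compactin X (snd p)" by auto
    have "\<bar>bump (snd p) v\<bar> * hs_norm H (?A (fst p)) \<le> \<bar>bump (snd p) v\<bar> * 1"
      using le1[OF i] by (intro mult_left_mono) auto
    also have "\<dots> \<le> 1"
      using bump01[OF K v] by simp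
    finally show "hs_norm H (localization X \<E> (diagonal_operator (bump (snd p)) (?A (fst p))) v) \<le> 1"
      by (simp add: hs_norm_diagonal[OF adj[OF i] v])
  qed
  show "net_to_one_on_compacts X (I \<times> {K. compactin X K}) (\<lambda>p q. leq (fst p) (fst q) \<and> snd p \<subseteq> snd q)
      (\<lambda>p v. hs_norm H (localization X \<E> (diagonal_operator (bump (snd p)) (?A (fst p))) v))"
    unfolding net_to_one_on_compacts_def
  proof (intro allI impI)
    fix K and \<epsilon> :: real assume K: "compactin X K" and e: "\<epsilon> > 0"
    \<comment> \<open>Over a point, uniform convergence on {u} is plain convergence of the
      norms.\<close>
    have "compactin Xu {u}"
      by (rule finite_imp_compactin) auto
    then obtain i where i: "i \<in> I" "\<And>j. j \<in> I \<Longrightarrow> leq i j \<Longrightarrow> norm (hs_norm H (?A j) - 1) < \<epsilon>"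
      using norm1 e unfolding net_to_one_on_compacts_def by blast
    show "\<exists>p\<in>I \<times> {K. compactin X K}. \<forall>q\<in>I \<times> {K. compactin X K}.
        leq (fst p) (fst q) \<and> snd p \<subseteq> snd q \<longrightarrow>
        (\<forall>v\<in>K. norm (hs_norm H (localization X \<E> (diagonal_operator (bump (snd q)) (?A (fst q))) v) - 1) < \<epsilon>)"
    proof (intro bexI[of _ "(i, K)"] ballI impI)
      show "(i, K) \<in> I \<times> {K. compactin X K}" using i K by simp
      fix q v assume q: "q \<in> I \<times> {K. compactin X K}"
        and le: "leq (fst (i, K)) (fst q) \<and> snd (i, K) \<subseteq> snd q" and v: "v \<in> K"
      have "v \<in> units G"
        using compactin_subset_topspace[OF K] v by auto
      moreover have "bump (snd q) v = 1"
        using q le v by (intro bump1) auto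
      ultimately show "norm (hs_norm H (localization X \<E> (diagonal_operator (bump (snd q)) (?A (fst q))) v) - 1) < \<epsilon>"
        using i(2)[of "fst q"] q le hs_norm_diagonal[OF adj, of "fst q" v "bump (snd q)"] by auto
    qed
  qed
  show "net_to_one_on_compacts (gtop G) (I \<times> {K. compactin X K}) (\<lambda>p q. leq (fst p) (fst q) \<and> snd p \<subseteq> snd q)
      (\<lambda>p x. hs_inner H
        (translate G \<pi>' x (localization X \<E> (diagonal_operator (bump (snd p)) (?A (fst p))) (gdom G x)))
        (localization X \<E> (diagonal_operator (bump (snd p)) (?A (fst p))) (grng G x)))"
    unfolding net_to_one_on_compacts_def
  proof (intro allI impI)
    fix C and \<epsilon> :: real assume C: "compactin (gtop G) C" and e: "\<epsilon> > 0"
    have "compactin (gtop (isotropy G u)) (retract ` C)"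
      by (rule image_compactin[OF C continuous_retract])
    then obtain i where i: "i \<in> I" and less: "\<forall>j\<in>I. leq i j \<longrightarrow> (\<forall>g\<in>retract ` C.
        norm (hs_inner (fibre E (grng G g)) (translate (isotropy G u) \<pi> g (localization Xu E (T j) (gdom G g)))
          (localization Xu E (T j) (grng G g)) - 1) < \<epsilon>)"
      using inner1 e unfolding net_to_one_on_compacts_def by meson
    \<comment> \<open>With this K, both scalars in \<open>hs_inner_diagonal\<close> are 1 for all x
      in C.\<close>
    define K where "K = gdom G ` C \<union> grng G ` C"
    have K: "compactin X K"
      unfolding K_def
      by (intro compactin_Un image_compactin[OF C continuous_gdom] image_compactin[OF C continuous_grng])
    show "\<exists>p\<in>I \<times> {K. compactin X K}. \<forall>q\<in>I \<times> {K. compactin X K}.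
        leq (fst p) (fst q) \<and> snd p \<subseteq> snd q \<longrightarrow>
        (\<forall>x\<in>C. norm (hs_inner H
          (translate G \<pi>' x (localization X \<E> (diagonal_operator (bump (snd q)) (?A (fst q))) (gdom G x)))
          (localization X \<E> (diagonal_operator (bump (snd q)) (?A (fst q))) (grng G x)) - 1) < \<epsilon>)"
    proof (intro bexI[of _ "(i, K)"] ballI impI)
      show "(i, K) \<in> I \<times> {K. compactin X K}" using i K by simp
      fix q x assume q: "q \<in> I \<times> {K. compactin X K}"
        and le: "leq (fst (i, K)) (fst q) \<and> snd (i, K) \<subseteq> snd q" and x: "x \<in> C"
      have xG: "x \<in> gset G"
        using compactin_subset_topspace[OF C] x by auto
      have "bump (snd q) (gdom G x) = 1" "bump (snd q) (grng G x) = 1"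
        using q le x unfolding K_def by (auto intro!: bump1)
      moreover have "norm (hs_inner H (translate (isotropy G u) \<pi> (retract x) (?A (fst q))) (?A (fst q)) - 1) < \<epsilon>"
        using less[rule_format, of "fst q" "retract x"] q le x retract_in[OF xG] by auto
      moreover have "fst q \<in> I" using q by auto
      ultimately show "norm (hs_inner H
          (translate G \<pi>' x (localization X \<E> (diagonal_operator (bump (snd q)) (?A (fst q))) (gdom G x)))
          (localization X \<E> (diagonal_operator (bump (snd q)) (?A (fst q))) (grng G x)) - 1) < \<epsilon>"
        by (simp add: hs_inner_diagonal[OF adj xG])
    qed
  qed
qed

end

theorem proposition5p5:
  fixes G :: "'g tgroupoid" and lam :: "'g \<Rightarrow> 'g measure" and u :: 'g and gam :: "'g \<Rightarrow> 'g"
    and E :: "('g, 'h) hilbert_bundle" and \<pi> :: "'g \<Rightarrow> 'h \<Rightarrow> 'h"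
  assumes "topological_groupoid G"
    and "second_countable (gtop G)"
    and "locally_compact_space (gtop G)"
    and "Hausdorff_space (gtop G)"
    and "transitive_groupoid G"
    and "left_haar_system G lam"
    and "u \<in> units G"
    and "continuous_map (unit_space G) (subtopology (gtop G) (domain_fibre G u)) gam"
    and "\<forall>v\<in>units G. grng G (gam v) = v"
    and "amenable_rep (isotropy G u) E \<pi>"
  shows "\<exists>(E' :: ('g, 'h) hilbert_bundle) \<pi>'.
    amenable_rep G E' \<pi>' \<and> unitarily_equivalent_at G u E' \<pi>' E \<pi>"
proof -
  interpret groupoid_rep G u gam E \<pi>
    by unfold_locales (use assms in \<open>auto simp: amenable_rep_def\<close>)
  obtain I :: "(('g, 'h) section_operator \<times> ('g, 'h) section_operator set) set" and leq T
    where "amenability_net (isotropy G u) E \<pi> I leq T"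
    using assms(10) unfolding amenable_rep_def by blast
  \<comment> \<open>The pairs with compact sets form an index type other than the one in
    \<open>amenable_rep\<close>; \<open>amenable_repI\<close> allows any.\<close>
  then have "amenable_rep G \<E> \<pi>'"
    by (intro amenable_repI[OF unitary_rep' amenability_net'])
  then show ?thesis
    using unitarily_equivalent by blast
qed

end
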